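(* Let $d\ge2$ be a square-free integer and let $T$ be a regular interval exchange transformation on $[\ell,r[$ such that $\ell$, all separation points $\gamma_i$ and all translation values $\alpha_{a}$ lie in $\mathbb{Z}[\sqrt d]$. Then $\Pi(J)=\Theta(1)$ for every semi-interval $J$ admissible for $T$; that is, there are constants $0<C_1\le C_2$ depending only on $T$ such that $C_1\le \Pi(J)\le C_2$ for every semi-interval $J\subseteq[\ell,r[$ admissible for $T$.
   Context: A semi-interval is a set $[x,y[=\{z\in\mathbb{R}: x\le z<y\}$ with $x<y$. Let $A=\{a_1<\dots<a_s\}$, $\lambda=(\lambda_1,\dots,\lambda_s)$ positive reals with $\sum\lambda_i=r-\ell$, $\pi$ a permutation of $A$. Put $\gamma_{a_i}=\ell+\sum_{j<i}\lambda_j$, $\delta_{a_i}=\ell+\sum_{j:\pi(a_j)<\pi(a_i)}\lambda_j$, $I_{a_i}=[\gamma_{a_i},\gamma_{a_i}+\lambda_i[$, translation values $\alpha_a=\delta_a-\gamma_a$. The interval exchange transformation $T:[\ell,r[\to[\ell,r[$ is $T(z)=z+\alpha_a$ for $z\in I_a$. Separation points: $\gamma_1=\ell,\dots,\gamma_s$ ($\gamma_i=\gamma_{a_i}$). $T$ is regular if the orbits $\{T^n(\gamma_i):n\in\mathbb{Z}\}$ of $\gamma_2,\dots,\gamma_s$ are infinite and pairwise disjoint. Admissibility: for $I=[u,v[\subseteq[\ell,r[$ and $z\in[\ell,r[$ let $\rho^+_{I,T}(z)=\min\{n>0: T^n(z)\in\,]u,v[\}$, $\rho^-_{I,T}(z)=\min\{n\ge0: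 T^{-n}(z)\in\,]u,v[\}$, $N_{I,T}(z)=\{T^k(z): -\rho^-_{I,T}(z)\le k<\rho^+_{I,T}(z)\}$, $\mathrm{Div}(I,T)=\bigcup_{i=1}^s N_{I,T}(\gamma_i)$. $I=[u,v[$ ($\ell\le u<v\le r$) is admissible for $T$ if $u,v\in\mathrm{Div}(I,T)\cup\{r\}$. Complexity: for $z=m+n\sqrt d\in\mathbb{Z}[\sqrt d]$ put $\Psi(z)=\max(|m|,|n|)$. For a semi-interval $J=[t,w[$ with $t,w\in\mathbb{Z}[\sqrt d]$ put $\Psi(J)=\max\{\Psi(t),\Psi(w)\}$ (the maximum of $\Psi$ over the boundary of $J$) and the reduced complexity $\Pi(J)=|J|\,\Psi(J)$, where $|J|$ is the length of $J$. (Endpoints of admissible semi-intervals lie in $\mathbb{Z}[\sqrt d]$ under the hypotheses.) *)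

theory Defs
  imports
    "HOL-Analysis.Analysis"
    "HOL-Computational_Algebra.Computational_Algebra"
    "HOL-Combinatorics.Permutations"
begin

section \<open>Interval exchange transformations\<close>

text \<open>
  The data are an interval \<open>[l, r[\<close>, a finite set \<open>A\<close> of letters of a linearly ordered type,
  lengths \<open>lam\<close> and a permutation \<open>\<pi>\<close> of \<open>A\<close>. The letters \<open>a\<^sub>1 < \<dots> < a\<^sub>s\<close> are the elements
  of \<open>A\<close> in increasing order. That \<open>A\<close> is nonempty follows from \<open>l < r\<close>.
\<close>

definition iet_data :: "real \<Rightarrow> real \<Rightarrow> 'a::linorder set \<Rightarrow> ('a \<Rightarrow> real) \<Rightarrow> ('a \<Rightarrow> 'a) \<Rightarrow> bool" where
  "iet_data l r A lam \<pi> \<longleftrightarrow>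
     l < r \<and> finite A \<and> (\<forall>a\<in>A. 0 < lam a) \<and> (\<Sum>a\<in>A. lam a) = r - l \<and> \<pi> permutes A"

definition iet_gamma :: "real \<Rightarrow> 'a::linorder set \<Rightarrow> ('a \<Rightarrow> real) \<Rightarrow> 'a \<Rightarrow> real" where
  "iet_gamma l A lam a = l + (\<Sum>b\<in>{b \<in> A. b < a}. lam b)"

definition iet_delta ::
    "real \<Rightarrow> 'a::linorder set \<Rightarrow> ('a \<Rightarrow> real) \<Rightarrow> ('a \<Rightarrow> 'a) \<Rightarrow> 'a \<Rightarrow> real" where
  "iet_delta l A lam \<pi> a = l + (\<Sum>b\<in>{b \<in> A. \<pi> b < \<pi> a}. lam b)"

definition iet_interval :: "real \<Rightarrow> 'a::linorder set \<Rightarrow> ('a \<Rightarrow> real) \<Rightarrow> 'a \<Rightarrow> real set" where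
  "iet_interval l A lam a = {iet_gamma l A lam a ..< iet_gamma l A lam a + lam a}"

definition iet_alpha ::
    "real \<Rightarrow> 'a::linorder set \<Rightarrow> ('a \<Rightarrow> real) \<Rightarrow> ('a \<Rightarrow> 'a) \<Rightarrow> 'a \<Rightarrow> real" where
  "iet_alpha l A lam \<pi> a = iet_delta l A lam \<pi> a - iet_gamma l A lam a"

text \<open>
  The intervals \<open>I\<^sub>a\<close>, for \<open>a\<close> in \<open>A\<close>, partition \<open>[l, r[\<close>, so the letter below is unique. The map
  is extended by the identity outside \<open>[l, r[\<close>; it is then a bijection of the whole real line
  preserving \<open>[l, r[\<close>, and \<^const>\<open>inv\<close> yields the inverse of the transformation on \<open>[l, r[\<close>.
\<close>

definition iet_map ::
    "real \<Rightarrow> 'a::linorder set \<Rightarrow> ('a \<Rightarrow> real) \<Rightarrow> ('a \<Rightarrow> 'a) \<Rightarrow> real \<Rightarrow> real" where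
  "iet_map l A lam \<pi> z =
     (if \<exists>a\<in>A. z \<in> iet_interval l A lam a
      then z + iet_alpha l A lam \<pi> (THE a. a \<in> A \<and> z \<in> iet_interval l A lam a)
      else z)"

definition zpow :: "('b \<Rightarrow> 'b) \<Rightarrow> int \<Rightarrow> 'b \<Rightarrow> 'b" where
  "zpow T k = (if 0 \<le> k then T ^^ nat k else inv T ^^ nat (- k))"

definition orbit_of :: "('b \<Rightarrow> 'b) \<Rightarrow> 'b \<Rightarrow> 'b set" where
  "orbit_of T z = {zpow T k z | k. True}"

text \<open>Only \<open>\<gamma>\<^sub>2, \<dots>, \<gamma>\<^sub>s\<close> are constrained: the least letter \<open>a\<^sub>1\<close>, with \<open>\<gamma>\<^sub>1 = l\<close>, is left out.\<close>

definition iet_regular ::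
    "real \<Rightarrow> 'a::linorder set \<Rightarrow> ('a \<Rightarrow> real) \<Rightarrow> ('a \<Rightarrow> 'a) \<Rightarrow> bool" where
  "iet_regular l A lam \<pi> \<longleftrightarrow>
     (\<forall>a\<in>A - {Min A}. infinite (orbit_of (iet_map l A lam \<pi>) (iet_gamma l A lam a))) \<and>
     (\<forall>a\<in>A - {Min A}. \<forall>b\<in>A - {Min A}. a \<noteq> b \<longrightarrow>
        orbit_of (iet_map l A lam \<pi>) (iet_gamma l A lam a) \<inter>
        orbit_of (iet_map l A lam \<pi>) (iet_gamma l A lam b) = {})"


section \<open>Admissible semi-intervals\<close>

text \<open>
  The two times below are minima of sets of natural numbers. They are taken in \<^typ>\<open>enat\<close>, so that
  the value is \<open>\<infinity>\<close> if the open interval \<open>]u, v[\<close> is never visited.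
\<close>

definition rho_plus :: "(real \<Rightarrow> real) \<Rightarrow> real \<Rightarrow> real \<Rightarrow> real \<Rightarrow> enat" where
  "rho_plus T u v z = Inf (enat ` {n. 0 < n \<and> zpow T (int n) z \<in> {u<..<v}})"

definition rho_minus :: "(real \<Rightarrow> real) \<Rightarrow> real \<Rightarrow> real \<Rightarrow> real \<Rightarrow> enat" where
  "rho_minus T u v z = Inf (enat ` {n. zpow T (- int n) z \<in> {u<..<v}})"

definition neighbours :: "(real \<Rightarrow> real) \<Rightarrow> real \<Rightarrow> real \<Rightarrow> real \<Rightarrow> real set" where
  "neighbours T u v z =
     {zpow T k z | k. - ereal_of_enat (rho_minus T u v z) \<le> ereal (of_int k) \<and>
                      ereal (of_int k) < ereal_of_enat (rho_plus T u v z)}"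

definition iet_Div ::
    "real \<Rightarrow> 'a::linorder set \<Rightarrow> ('a \<Rightarrow> real) \<Rightarrow> ('a \<Rightarrow> 'a) \<Rightarrow> real \<Rightarrow> real \<Rightarrow> real set" where
  "iet_Div l A lam \<pi> u v = (\<Union>a\<in>A. neighbours (iet_map l A lam \<pi>) u v (iet_gamma l A lam a))"

definition iet_admissible ::
    "real \<Rightarrow> real \<Rightarrow> 'a::linorder set \<Rightarrow> ('a \<Rightarrow> real) \<Rightarrow> ('a \<Rightarrow> 'a) \<Rightarrow> real \<Rightarrow> real \<Rightarrow> bool" where
  "iet_admissible l r A lam \<pi> u v \<longleftrightarrow>
     l \<le> u \<and> u < v \<and> v \<le> r \<and>
     u \<in> iet_Div l A lam \<pi> u v \<union> {r} \<and> v \<in> iet_Div l A lam \<pi> u v \<union> {r}"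


section \<open>Complexity\<close>

definition Zsqrt :: "int \<Rightarrow> real set" where
  "Zsqrt d = {of_int m + of_int n * sqrt (of_int d) | m n. True}"

text \<open>
  For \<open>z\<close> in \<^term>\<open>Zsqrt d\<close> with \<open>d \<ge> 2\<close> square-free, the coefficients \<open>m\<close> and \<open>n\<close> are unique
  because \<open>\<surd>d\<close> is irrational; for other \<open>z\<close> the value is unspecified.
\<close>

definition Psi :: "int \<Rightarrow> real \<Rightarrow> real" where
  "Psi d z = (THE p. \<exists>m n :: int. z = of_int m + of_int n * sqrt (of_int d) \<and>
                                  p = of_int (max \<bar>m\<bar> \<bar>n\<bar>))"

text \<open>A semi-interval \<open>[t, w[\<close> is given by its endpoints \<open>t < w\<close>.\<close>

definition Psi_interval :: "int \<Rightarrow> real \<Rightarrow> real \<Rightarrow> real" where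
  "Psi_interval d t w = max (Psi d t) (Psi d w)"

definition reduced_complexity :: "int \<Rightarrow> real \<Rightarrow> real \<Rightarrow> real" where
  "reduced_complexity d t w = (w - t) * Psi_interval d t w"

end

theory Submission
  imports Defs
begin

text \<open>
  A nonzero \<open>m + n\<surd>d\<close> is at least \<open>1 / (\<bar>m\<bar> + \<bar>n\<bar>\<surd>d)\<close> in absolute value, because its norm is a
  nonzero integer; this gives the lower bound at once. For the upper bound let \<open>\<epsilon>\<close> be the length of an
  admissible \<open>[u, v[\<close>. An endpoint other than \<open>r\<close> is \<open>T\<^sup>k \<gamma>\<^sub>i\<close> with \<open>k\<close> bounded by the times at which
  the orbit of \<open>\<gamma>\<^sub>i\<close> visits \<open>]u, v[\<close>, and its coefficients are \<open>O(1 + \<bar>k\<bar>)\<close>, so it suffices that these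
  times are \<open>O(1/\<epsilon>)\<close>.

  By Dirichlet's theorem \<open>]u, v[\<close> contains some \<open>J = [u', v'[\<close> whose endpoints have coefficients at most
  \<open>n = O(1/\<epsilon>)\<close>. For \<open>k \<ge> n\<close> the intervals on which the first \<open>k\<close> iterates are translations that respect
  \<open>J\<close> have endpoints with coefficients \<open>O(k)\<close> and hence length at least \<open>c/k\<close>. A hitting or return time
  \<open>N\<close> would give disjoint intervals of length \<open>c/k\<close> for \<open>n \<le> k \<le> N\<close>, so \<open>\<Sum> c/k \<le> r - l\<close> and
  \<open>N = O(n)\<close>. The set of points whose orbit visits \<open>J\<close> is therefore a finite union of intervals, it is
  invariant, and a boundary point of it would yield a connection \<open>T\<^sup>m \<gamma>\<^sub>b = \<gamma>\<^sub>a\<close>, which regularity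
  excludes (Keane's argument). So every orbit visits \<open>J\<close> within time \<open>O(n)\<close>.
\<close>

section \<open>Bounded elements of the quadratic ring\<close>

locale quadratic =
  fixes d :: int
  assumes d_ge: "2 \<le> d" and d_sqf: "squarefree d"
begin

abbreviation s :: real where "s \<equiv> sqrt (of_int d)"

lemma s_gt1: "1 < s"
  using d_ge by simp

lemma s_square: "s * s = of_int d"
  using d_ge by simp

text \<open>If \<open>n\<close> were nonzero, \<open>m^2 = n^2 d\<close> would make \<open>n\<close>
  divide \<open>m\<close> and \<open>d\<close> a perfect square, which \<open>squarefree d\<close>
  and \<open>2 \<le> d\<close> exclude.\<close>

lemma sqrt_independent:
  fixes m n :: int
  assumes "of_int m + of_int n * s = 0"
  shows "m = 0 \<and> n = 0"
proof (cases "n = 0")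
  case False
  have "(of_int m)\<^sup>2 = (of_int n * s)\<^sup>2"
    using assms by (metis add_eq_0_iff power2_minus)
  also have "\<dots> = of_int (n\<^sup>2 * d)"
    using s_square by (simp add: power2_eq_square algebra_simps)
  finally have eq: "m\<^sup>2 = n\<^sup>2 * d"
    by (metis of_int_eq_iff of_int_power)
  then have "n\<^sup>2 dvd m\<^sup>2" by simp
  then have "n dvd m" by (simp add: pow_divides_pow_iff)
  then obtain j where "m = n * j" by blast
  then have "d = j\<^sup>2" using eq False by (simp add: power_mult_distrib)
  then have "j dvd 1" using d_sqf by (auto simp: squarefree_def)
  then have "d = 1" using \<open>d = j\<^sup>2\<close> by (auto simp: zdvd1_eq power2_eq_1_iff abs_if split: if_splits)
  then show ?thesis using d_ge by simp
qed (use assms in auto)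

text \<open>On \<open>Zsqrt d\<close> membership amounts to \<open>Psi d z \<le> B\<close>, but
  without the description operator and in a form where bounds simply add.\<close>

definition bounded_ring :: "real \<Rightarrow> real set" where
  "bounded_ring B = {of_int m + of_int n * s | m n. \<bar>of_int m\<bar> \<le> B \<and> \<bar>of_int n\<bar> \<le> B}"

lemma bounded_ringI:
  "\<bar>of_int m\<bar> \<le> B \<Longrightarrow> \<bar>of_int n\<bar> \<le> B \<Longrightarrow> z = of_int m + of_int n * s \<Longrightarrow> z \<in> bounded_ring B"
  unfolding bounded_ring_def by auto

lemma bounded_ring_zero: "0 \<le> B \<Longrightarrow> 0 \<in> bounded_ring B"
  by (rule bounded_ringI[of 0 _ 0]) auto

lemma bounded_ring_mono: "z \<in> bounded_ring B \<Longrightarrow> B \<le> C \<Longrightarrow> z \<in> bounded_ring C"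
  unfolding bounded_ring_def by fastforce

lemma bounded_ring_add:
  assumes "x \<in> bounded_ring B" "y \<in> bounded_ring C"
  shows "x + y \<in> bounded_ring (B + C)"
proof -
  obtain m n m' n' where "x = of_int m + of_int n * s" "\<bar>of_int m\<bar> \<le> B" "\<bar>of_int n\<bar> \<le> B"
    "y = of_int m' + of_int n' * s" "\<bar>of_int m'\<bar> \<le> C" "\<bar>of_int n'\<bar> \<le> C"
    using assms unfolding bounded_ring_def by blast
  then show ?thesis
    by (intro bounded_ringI[of "m + m'" _ "n + n'"]) (auto simp: algebra_simps)
qed

lemma bounded_ring_uminus:
  assumes "x \<in> bounded_ring B"
  shows "- x \<in> bounded_ring B"
proof -
  obtain m n where "x = of_int m + of_int n * s" "\<bar>of_int m\<bar> \<le> B" "\<bar>of_int n\<bar> \<le> B"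
    using assms unfolding bounded_ring_def by blast
  then show ?thesis
    by (intro bounded_ringI[of "- m" _ "- n"]) (auto simp: algebra_simps)
qed

lemma bounded_ring_diff:
  "x \<in> bounded_ring B \<Longrightarrow> y \<in> bounded_ring C \<Longrightarrow> x - y \<in> bounded_ring (B + C)"
  using bounded_ring_add[OF _ bounded_ring_uminus] by fastforce

lemma Zsqrt_bounded:
  assumes "z \<in> Zsqrt d"
  obtains B where "0 \<le> B" "z \<in> bounded_ring B"
proof -
  obtain m n where "z = of_int m + of_int n * s" using assms unfolding Zsqrt_def by blast
  then have "z \<in> bounded_ring (max \<bar>of_int m\<bar> \<bar>of_int n\<bar>)"
    by (intro bounded_ringI) auto
  then show ?thesis using that[of "max \<bar>of_int m\<bar> \<bar>of_int n\<bar>"] by simp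
qed

lemma Zsqrt_finite_bounded:
  assumes "finite F" "F \<subseteq> Zsqrt d"
  obtains B where "0 \<le> B" "F \<subseteq> bounded_ring B"
  using assms
proof (induction arbitrary: thesis)
  case empty
  then show ?case by auto
next
  case (insert x F)
  obtain B where B: "0 \<le> B" "F \<subseteq> bounded_ring B" using insert by auto
  obtain C where "0 \<le> C" "x \<in> bounded_ring C" using insert.prems Zsqrt_bounded by auto
  then show ?case using B insert.prems(1)[of "max B C"]
    by (meson bounded_ring_mono insert_subset le_max_iff_disj max.cobounded1 max.cobounded2 subset_iff)
qed

lemma bounded_ring_Zsqrt: "z \<in> bounded_ring B \<Longrightarrow> z \<in> Zsqrt d"
  unfolding bounded_ring_def Zsqrt_def by blast

lemma Zsqrt_add: "x \<in> Zsqrt d \<Longrightarrow> y \<in> Zsqrt d \<Longrightarrow> x + y \<in> Zsqrt d"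
  by (meson Zsqrt_bounded bounded_ring_Zsqrt bounded_ring_add)

text \<open>The norm \<open>m^2 - n^2 d\<close> is a nonzero integer, so \<open>x\<close> is at
  least the reciprocal of the absolute value of its conjugate, which is at most
  \<open>(1 + s) * B\<close>.\<close>

lemma bounded_ring_lower:
  assumes "x \<in> bounded_ring B" "x > 0"
  shows "1 / ((1 + s) * B) \<le> x"
proof -
  obtain m n where x: "x = of_int m + of_int n * s" and mn: "\<bar>of_int m\<bar> \<le> B" "\<bar>of_int n\<bar> \<le> B"
    using assms(1) unfolding bounded_ring_def by blast
  let ?y = "of_int m - of_int n * s"
  have "m \<noteq> 0 \<or> n \<noteq> 0" using x assms(2) by auto
  then have "?y \<noteq> 0" using sqrt_independent[of m "- n"] by auto
  have "x * ?y = of_int (m * m - n * n * d)"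
    unfolding x using s_square by (simp add: algebra_simps)
  moreover have "x * ?y \<noteq> 0" using \<open>?y \<noteq> 0\<close> assms(2) by simp
  ultimately have "1 \<le> \<bar>x * ?y\<bar>"
    by (metis int_one_le_iff_zero_less of_int_0_eq_iff of_int_1_le_iff of_int_abs zero_less_abs_iff)
  also have "\<dots> = x * \<bar>?y\<bar>" using assms(2) by (simp add: abs_mult)
  also have "\<bar>?y\<bar> \<le> \<bar>of_int m\<bar> + \<bar>of_int n\<bar> * s"
    using s_gt1 abs_triangle_ineq4[of "of_int m" "of_int n * s"] by (simp add: abs_mult)
  also have "\<dots> \<le> B + B * s" using mn s_gt1 by (intro add_mono mult_right_mono) auto
  finally have le: "1 \<le> x * ((1 + s) * B)" using assms(2) by (simp add: algebra_simps)
  then have "0 < (1 + s) * B" using assms(2) by (smt (verit) mult_nonneg_nonpos)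
  then show ?thesis using le by (simp add: divide_le_eq)
qed

section \<open>Complexity and its lower bound\<close>

lemma Psi_eq: "Psi d (of_int m + of_int n * s) = of_int (max \<bar>m\<bar> \<bar>n\<bar>)"
  unfolding Psi_def
proof (rule the_equality)
  fix p :: real
  assume "\<exists>m' n'. of_int m + of_int n * s = of_int m' + of_int n' * s \<and> p = of_int (max \<bar>m'\<bar> \<bar>n'\<bar>)"
  then obtain m' n' where *: "of_int m + of_int n * s = of_int m' + of_int n' * s"
    "p = of_int (max \<bar>m'\<bar> \<bar>n'\<bar>)" by blast
  then have "m - m' = 0 \<and> n - n' = 0"
    by (intro sqrt_independent) (simp add: algebra_simps)
  then show "p = of_int (max \<bar>m\<bar> \<bar>n\<bar>)" using * by simp
qed auto

lemma Psi_le: "z \<in> bounded_ring B \<Longrightarrow> Psi d z \<le> B"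
  unfolding bounded_ring_def by (auto simp: Psi_eq)

lemma bounded_ring_Psi: "z \<in> Zsqrt d \<Longrightarrow> z \<in> bounded_ring (Psi d z)"
  unfolding bounded_ring_def Zsqrt_def
  by (auto simp: Psi_eq simp del: of_int_max) (metis abs_le_iff max.cobounded1 max.cobounded2 of_int_abs of_int_le_iff)

text \<open>The length \<open>v - u\<close> is a positive ring element with coefficients at most
  twice the complexity.\<close>

lemma reduced_complexity_lower:
  assumes "u \<in> Zsqrt d" "v \<in> Zsqrt d" "u < v"
  shows "1 / (2 * (1 + s)) \<le> reduced_complexity d u v"
proof -
  let ?P = "Psi_interval d u v"
  have "v - u \<in> bounded_ring (Psi d v + Psi d u)"
    using assms by (intro bounded_ring_diff bounded_ring_Psi)
  then have "v - u \<in> bounded_ring (2 * ?P)"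
    by (rule bounded_ring_mono) (simp add: Psi_interval_def)
  then have le: "1 / ((1 + s) * (2 * ?P)) \<le> v - u"
    using bounded_ring_lower assms(3) by simp
  have "?P \<noteq> 0"
  proof
    assume "?P = 0"
    then have "v - u \<in> bounded_ring 0" using \<open>v - u \<in> bounded_ring (2 * ?P)\<close> by simp
    then have "v - u = 0" unfolding bounded_ring_def by auto
    then show False using assms by simp
  qed
  moreover have "0 \<le> ?P"
    using assms unfolding Zsqrt_def Psi_interval_def by (auto simp: Psi_eq)
  ultimately have "0 < ?P" by simp
  moreover have "1 / (2 * (1 + s)) = 1 / ((1 + s) * (2 * ?P)) * ?P" using \<open>0 < ?P\<close> s_gt1 by simp
  ultimately show ?thesis using mult_right_mono[OF le, of ?P]
    by (simp add: reduced_complexity_def mult.commute)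
qed

section \<open>Ring elements with controlled coefficients in short intervals\<close>

text \<open>The conjugate is \<open>(m + n s) - 2 n s\<close>; it stays bounded if
  \<open>2 n s\<close> is the last multiple of \<open>2 s\<close> up to \<open>x\<close> and
  \<open>m\<close> then brings \<open>m + n s\<close> into the unit interval.\<close>

lemma bounded_conjugate_in_unit_interval:
  obtains m n :: int where "x < of_int m + of_int n * s" "of_int m + of_int n * s \<le> x + 1"
    "\<bar>of_int m - of_int n * s\<bar> \<le> 2 * s + 1"
proof -
  define n where "n = \<lfloor>x / (2 * s)\<rfloor>"
  define m where "m = \<lfloor>x - of_int n * s\<rfloor> + 1"
  have "of_int n \<le> x / (2 * s)" "x / (2 * s) < of_int n + 1" unfolding n_def by linarith+
  then have "of_int n * (2 * s) \<le> x" "x < (of_int n + 1) * (2 * s)"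
    using s_gt1 by (simp_all add: field_simps)
  moreover have "of_int m \<le> x - of_int n * s + 1" "x - of_int n * s < of_int m" unfolding m_def by linarith+
  ultimately show ?thesis using s_gt1 by (intro that[of m n]) (auto simp: algebra_simps abs_if)
qed

text \<open>
  Multiply a point with bounded conjugate by a Dirichlet approximation \<open>\<beta> = k\<surd>d - h\<close> of size less
  than \<open>1/N\<close>, whose conjugate is \<open>O(N)\<close>.
\<close>

lemma dense_at_scale:
  assumes N: "N > (0::nat)" and len: "1 \<le> real N * (v - u)"
  obtains z where "u < z" "z < v"
    "z \<in> bounded_ring (\<bar>u\<bar> + \<bar>v\<bar> + (2 * s + 1)\<^sup>2 * real N)"
proof -
  obtain h0 k0 where k0: "0 < k0" "k0 \<le> int N" and hk0: "\<bar>of_int k0 * s - of_int h0\<bar> < 1 / N"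
    using Dirichlet_approx[OF N] by blast
  \<comment> \<open>The approximation may have either sign; being nonzero, it becomes positive after
    a change of sign if necessary.\<close>
  have "of_int k0 * s - of_int h0 \<noteq> 0" using sqrt_independent[of "- h0" k0] k0 by auto
  then obtain h k where b0: "of_int k * s - of_int h > 0" and bN: "of_int k * s - of_int h < 1 / N"
    and k: "\<bar>k\<bar> \<le> int N"
  proof (cases "of_int k0 * s - of_int h0 > 0")
    case True
    then show ?thesis using k0 hk0 by (intro that[of k0 h0]) auto
  next
    case False
    then show ?thesis using k0 hk0 \<open>of_int k0 * s - of_int h0 \<noteq> 0\<close>
      by (intro that[of "- k0" "- h0"]) auto
  qed
  define b where "b = of_int k * s - of_int h"
  define b' where "b' = - (of_int k * s) - of_int h"
  have b: "0 < b" "b * N < 1" using b0 bN N by (auto simp: b_def field_simps)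
  \<comment> \<open>Multiplication by \<open>b\<close> maps \<open>]u/b, u/b + 1]\<close> to
    \<open>]u, u + b]\<close>, which stays below \<open>v\<close> because
    \<open>b < 1/N \<le> v - u\<close>.\<close>
  obtain m n where w: "u / b < of_int m + of_int n * s" "of_int m + of_int n * s \<le> u / b + 1"
    and w': "\<bar>of_int m - of_int n * s\<bar> \<le> 2 * s + 1"
    by (rule bounded_conjugate_in_unit_interval)
  define z where "z = b * (of_int m + of_int n * s)"
  define z' where "z' = b' * (of_int m - of_int n * s)"
  have "u < z" using w(1) b(1) by (simp add: z_def field_simps)
  have "z \<le> u + b" using w(2) b(1) mult_left_mono[OF w(2), of b] by (simp add: z_def algebra_simps)
  moreover have "b < v - u"
  proof -
    have "b * N < (v - u) * N" using b(2) len by (simp add: mult.commute)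
    then show ?thesis using N by simp
  qed
  ultimately have "z < v" by simp
  have "\<bar>of_int k\<bar> \<le> real N" using k by linarith
  then have ks: "\<bar>of_int k * s\<bar> \<le> N * s"
    using s_gt1 by (simp add: abs_mult)
  have "b \<le> b * N" using b N by simp
  then have "b < 1" using b(2) by linarith
  have "b' = b - 2 * (of_int k * s)" by (simp add: b_def b'_def)
  then have "\<bar>b'\<bar> \<le> 1 + 2 * (N * s)" using ks b(1) \<open>b < 1\<close> by linarith
  also have "\<dots> \<le> (2 * s + 1) * N" using N by (simp add: algebra_simps)
  finally have "\<bar>z'\<bar> \<le> ((2 * s + 1) * N) * (2 * s + 1)"
    unfolding z'_def abs_mult using w' s_gt1 by (intro mult_mono) auto
  then have z': "\<bar>z'\<bar> \<le> (2 * s + 1)\<^sup>2 * N" by (simp add: power2_eq_square mult_ac)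
  have z: "\<bar>z\<bar> \<le> \<bar>u\<bar> + \<bar>v\<bar>" using \<open>u < z\<close> \<open>z < v\<close> by linarith
  define p where "p = k * n * d - h * m"
  define q where "q = k * m - h * n"
  have "z = of_int k * of_int n * (s * s) - of_int h * of_int m + (of_int k * of_int m - of_int h * of_int n) * s"
    "z' = of_int k * of_int n * (s * s) - of_int h * of_int m - (of_int k * of_int m - of_int h * of_int n) * s"
    unfolding z_def z'_def b_def b'_def by algebra+
  then have zpq: "z = of_int p + of_int q * s" "z' = of_int p - of_int q * s"
    unfolding s_square p_def q_def by simp_all
  have "\<bar>of_int q\<bar> \<le> \<bar>of_int q * s\<bar>" using s_gt1 by (simp add: abs_mult mult_le_cancel_left1)
  \<comment> \<open>As \<open>z\<close> and \<open>z'\<close> are conjugate, \<open>p\<close> and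
    \<open>q s\<close> are half their sum and half their difference.\<close>
  then have "\<bar>of_int p\<bar> \<le> \<bar>z\<bar> + \<bar>z'\<bar>" "\<bar>of_int q\<bar> \<le> \<bar>z\<bar> + \<bar>z'\<bar>" using zpq by linarith+
  then have "z \<in> bounded_ring (\<bar>z\<bar> + \<bar>z'\<bar>)" using zpq by (intro bounded_ringI) auto
  then show ?thesis using \<open>u < z\<close> \<open>z < v\<close> z z' by (intro that[of z]) (auto elim: bounded_ring_mono)
qed

end

section \<open>The map as a bijection by local translations\<close>

locale iet =
  fixes l r :: real and A :: "'a::linorder set" and lam :: "'a \<Rightarrow> real" and \<pi> :: "'a \<Rightarrow> 'a"
  assumes data: "iet_data l r A lam \<pi>"
begin

abbreviation \<gamma> :: "'a \<Rightarrow> real" where "\<gamma> \<equiv> iet_gamma l A lam"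
abbreviation \<alpha> :: "'a \<Rightarrow> real" where "\<alpha> \<equiv> iet_alpha l A lam \<pi>"
abbreviation I :: "'a \<Rightarrow> real set" where "I \<equiv> iet_interval l A lam"
abbreviation T :: "real \<Rightarrow> real" where "T \<equiv> iet_map l A lam \<pi>"
abbreviation X :: "real set" where "X \<equiv> {l..<r}"

section \<open>Separation points and the partition of \<open>[l, r[\<close>\<close>

lemma lr: "l < r" and finA: "finite A" and lam_pos: "a \<in> A \<Longrightarrow> 0 < lam a"
  and sum_lam: "(\<Sum>a\<in>A. lam a) = r - l" and perm: "\<pi> permutes A"
  using data by (auto simp: iet_data_def)

lemma A_ne: "A \<noteq> {}" using sum_lam lr by auto

lemma gamma_add_lam: 
  assumes "a \<in> A"
  shows "\<gamma> a + lam a = l + (\<Sum>b\<in>{b \<in> A. b \<le> a}. lam b)"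
proof -
  have "{b \<in> A. b \<le> a} = insert a {b \<in> A. b < a}" using assms by auto
  then show ?thesis using finA by (simp add: iet_gamma_def)
qed

lemma gamma_mono:
  assumes "a \<in> A" "a < b"
  shows "\<gamma> a + lam a \<le> \<gamma> b"
proof -
  have "(\<Sum>c\<in>{c \<in> A. c \<le> a}. lam c) \<le> (\<Sum>c\<in>{c \<in> A. c < b}. lam c)"
    using assms finA lam_pos by (intro sum_mono2) (auto intro: less_imp_le)
  then show ?thesis unfolding gamma_add_lam[OF assms(1)] by (simp add: iet_gamma_def)
qed

text \<open>For the next letter \<open>b\<close>: every right end of an interval other than
  \<open>r\<close> is again a separation point.\<close>

lemma gamma_succ:
  assumes "a \<in> A" "a \<noteq> Max A"
  obtains b where "b \<in> A" "a < b" "\<gamma> b = \<gamma> a + lam a" "{c \<in> A. c < b} = {c \<in> A. c \<le> a}"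
proof -
  have "a < Max A" using assms finA by (simp add: order.strict_iff_order)
  then have ne: "{b \<in> A. a < b} \<noteq> {}" using Max_in[OF finA A_ne] by blast
  define b where "b = Min {b \<in> A. a < b}"
  have b: "b \<in> A" "a < b" using Min_in[OF _ ne] finA unfolding b_def by auto
  have "b \<le> c" if "c \<in> A" "a < c" for c using that finA unfolding b_def by simp
  then have eq: "{c \<in> A. c < b} = {c \<in> A. c \<le> a}" using b by fastforce
  then have "\<gamma> b = \<gamma> a + lam a" using gamma_add_lam[OF assms(1)] by (simp add: iet_gamma_def)
  then show ?thesis using that b eq by blast
qed

lemma gamma_Max: "\<gamma> (Max A) + lam (Max A) = r"
proof -
  have "{b \<in> A. b \<le> Max A} = A" using finA by auto
  then show ?thesis using gamma_add_lam[of "Max A"] finA A_ne sum_lam by simp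
qed

lemma gamma_Min: "\<gamma> (Min A) = l"
proof -
  have *: "{b \<in> A. b < Min A} = {}" using finA by (auto simp: not_less)
  show ?thesis unfolding iet_gamma_def * by simp
qed

lemma gamma_lt_r: 
  assumes "a \<in> A"
  shows "l \<le> \<gamma> a" "\<gamma> a + lam a \<le> r"
proof -
  show "l \<le> \<gamma> a" using lam_pos by (auto simp: iet_gamma_def intro!: sum_nonneg intro: less_imp_le)
  show "\<gamma> a + lam a \<le> r"
  proof (cases "a = Max A")
    case False
    then have "a < Max A" using assms finA by (simp add: order.strict_iff_order)
    from gamma_mono[OF assms this] show ?thesis
      using gamma_Max lam_pos[of "Max A"] finA A_ne by simp
  qed (simp add: gamma_Max)
qed

lemma gamma_in_X: "a \<in> A \<Longrightarrow> \<gamma> a \<in> X"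
  using gamma_lt_r[of a] lam_pos[of a] by auto

lemma gamma_in_I: "a \<in> A \<Longrightarrow> \<gamma> a \<in> I a"
  using lam_pos[of a] by (auto simp: iet_interval_def)

lemma I_subset: "a \<in> A \<Longrightarrow> I a \<subseteq> X"
  using gamma_lt_r[of a] by (auto simp: iet_interval_def)

lemma I_unique:
  assumes "a \<in> A" "b \<in> A" "z \<in> I a" "z \<in> I b"
  shows "a = b"
  using assms gamma_mono[of a b] gamma_mono[of b a]
  by (cases a b rule: linorder_cases) (auto simp: iet_interval_def)

lemma I_cover:
  assumes "z \<in> X"
  obtains a where "a \<in> A" "z \<in> I a"
proof -
  let ?S = "{a \<in> A. \<gamma> a \<le> z}"
  have "Min A \<in> ?S" using gamma_Min assms finA A_ne by simp
  then have ne: "?S \<noteq> {}" by blast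
  define a where "a = Max ?S"
  have a: "a \<in> A" "\<gamma> a \<le> z" using Max_in[OF _ ne] finA unfolding a_def by auto
  have max: "b \<le> a" if "b \<in> A" "\<gamma> b \<le> z" for b using that finA unfolding a_def by simp
  have "z < \<gamma> a + lam a"
  proof (cases "a = Max A")
    case True
    then show ?thesis using gamma_Max assms by simp
  next
    case False
    then obtain b where "b \<in> A" "a < b" "\<gamma> b = \<gamma> a + lam a" using gamma_succ a by blast
    then show ?thesis using max[of b] by force
  qed
  then show ?thesis using that a by (auto simp: iet_interval_def)
qed

lemma T_eq: 
  assumes "a \<in> A" "z \<in> I a"
  shows "T z = z + \<alpha> a"
proof -
  have "(THE a. a \<in> A \<and> z \<in> I a) = a"
    using assms I_unique by (intro the_equality) auto
  then show ?thesis using assms by (auto simp: iet_map_def)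
qed

lemma T_outside: "z \<notin> X \<Longrightarrow> T z = z"
  using I_subset unfolding iet_map_def by (metis subsetD)

lemma T_gamma: "a \<in> A \<Longrightarrow> T (\<gamma> a) = iet_delta l A lam \<pi> a"
  using T_eq[OF _ gamma_in_I] by (simp add: iet_alpha_def)

end

text \<open>
  Relabelling the letter \<open>a\<close> as \<open>\<pi> a\<close> turns the image intervals into the intervals of another exchange,
  so that facts about the points \<open>\<gamma>\<close> carry over to the points \<open>\<delta>\<close>.
\<close>

lemma iet_delta_eq_gamma:
  assumes "\<pi> permutes A" "a \<in> A"
  shows "iet_delta l A lam \<pi> a = iet_gamma l A (lam \<circ> inv \<pi>) (\<pi> a)"
proof -
  have inj: "inj \<pi>" using assms(1) by (simp add: permutes_inj)
  have "{c \<in> A. c < \<pi> a} = \<pi> ` {b \<in> A. \<pi> b < \<pi> a}"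
    using permutes_image[OF assms(1)] by (auto simp: image_iff)
  then have "sum (lam \<circ> inv \<pi>) {c \<in> A. c < \<pi> a} = sum lam {b \<in> A. \<pi> b < \<pi> a}"
    using inj by (simp add: sum.reindex inj_on_subset[OF inj] o_def inv_f_f)
  then show ?thesis by (simp add: iet_delta_def iet_gamma_def)
qed

lemma iet_relabel:
  assumes "iet_data l r A lam \<pi>"
  shows "iet_data l r A (lam \<circ> inv \<pi>) (inv \<pi>)"
proof -
  have p: "\<pi> permutes A" using assms by (simp add: iet_data_def)
  then have "inv \<pi> permutes A" by (rule permutes_inv)
  moreover have "sum (lam \<circ> inv \<pi>) A = sum lam A"
    using sum.permute[OF \<open>inv \<pi> permutes A\<close>, of lam] by simp
  ultimately show ?thesis using assms permutes_in_image[of "inv \<pi>" A]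
    by (auto simp: iet_data_def)
qed

context iet
begin

section \<open>Image intervals and bijectivity\<close>

abbreviation \<delta> :: "'a \<Rightarrow> real" where "\<delta> \<equiv> iet_delta l A lam \<pi>"

lemma image_intervals:
  assumes "a \<in> A"
  shows "{\<delta> a..<\<delta> a + lam a} = iet_interval l A (lam \<circ> inv \<pi>) (\<pi> a)"
  using iet_delta_eq_gamma[OF perm assms, of l lam] permutes_inverses(2)[OF perm]
  by (simp add: iet_interval_def)

lemma T_in_image: "a \<in> A \<Longrightarrow> z \<in> I a \<Longrightarrow> T z \<in> {\<delta> a..<\<delta> a + lam a}"
  using T_eq[of a z] by (auto simp: iet_interval_def iet_alpha_def)

lemma T_in_X: "z \<in> X \<Longrightarrow> T z \<in> X"
proof -
  assume "z \<in> X"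
  then obtain a where a: "a \<in> A" "z \<in> I a" by (rule I_cover)
  interpret R: iet l r A "lam \<circ> inv \<pi>" "inv \<pi>"
    using iet_relabel[OF data] by unfold_locales
  show ?thesis using T_in_image[OF a] image_intervals[OF a(1)] R.I_subset[of "\<pi> a"]
      permutes_in_image[OF perm] a(1) by blast
qed

text \<open>The image intervals, being the intervals of the relabelled exchange, partition
  \<open>[l, r[\<close> again, and each is a translate of its source; elsewhere the map is the
  identity.\<close>

lemma bij_T: "bij T"
proof (rule bijI)
  interpret R: iet l r A "lam \<circ> inv \<pi>" "inv \<pi>"
    using iet_relabel[OF data] by unfold_locales
  show "inj T"
  proof (rule injI)
    fix x y assume eq: "T x = T y"
    show "x = y"
    proof (cases "x \<in> X \<and> y \<in> X")
      case True
      then obtain a b where a: "a \<in> A" "x \<in> I a" and b: "b \<in> A" "y \<in> I b" by (metis I_cover)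
      have "T x \<in> R.I (\<pi> a)" "T x \<in> R.I (\<pi> b)"
        using T_in_image[OF a] T_in_image[OF b] eq image_intervals a b by auto
      then have "\<pi> a = \<pi> b" using R.I_unique permutes_in_image[OF perm] a b by blast
      then have "a = b" using permutes_inj[OF perm] by (auto dest: injD)
      then show ?thesis using eq T_eq[OF a] T_eq[OF b] by simp
    next
      case False
      then show ?thesis using eq T_in_X T_outside by metis
    qed
  qed
  show "surj T"
  unfolding surj_def
  proof
    fix y
    show "\<exists>x. y = T x"
    proof (cases "y \<in> X")
      case True
      then obtain b where b: "b \<in> A" "y \<in> R.I b" by (rule R.I_cover)
      define a where "a = inv \<pi> b"
      have a: "a \<in> A" "\<pi> a = b"
        using b(1) permutes_in_image[OF R.perm] permutes_inverses[OF perm] by (auto simp: a_def)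
      then have y: "y \<in> {\<delta> a..<\<delta> a + lam a}" using image_intervals b by simp
      then have "y - \<alpha> a \<in> I a" by (auto simp: iet_interval_def iet_alpha_def)
      from T_eq[OF a(1) this] show ?thesis by (auto intro: exI[of _ "y - \<alpha> a"])
    qed (metis T_outside)
  qed
qed

section \<open>Iterates and the intervals they translate\<close>

lemma T_pow_in_X: "z \<in> X \<Longrightarrow> (T ^^ k) z \<in> X"
  by (induction k) (simp_all only: funpow.simps o_apply id_apply T_in_X)

lemma T_inj: "T x = T y \<longleftrightarrow> x = y"
  using bij_T by (auto simp: bij_def dest: injD)

lemma T_pow_inj: "(T ^^ k) x = (T ^^ k) y \<longleftrightarrow> x = y"
  by (induction k) (auto simp: T_inj)

lemma T_inv_pow: "(T ^^ k) ((inv T ^^ k) z) = z"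
  using fn_o_inv_fn_is_id[OF bij_T, of k] by (metis comp_apply)

lemma T_in_X_iff: "T z \<in> X \<longleftrightarrow> z \<in> X"
  using T_in_X T_outside by metis

lemma T_pow_in_X_iff: "(T ^^ k) z \<in> X \<longleftrightarrow> z \<in> X"
  by (induction k) (simp_all only: funpow.simps o_apply id_apply T_in_X_iff)

text \<open>The points of \<open>P\<close> cut \<open>[l, r[\<close> into cells. As all ends of the
  intervals \<open>I a\<close> are in \<open>P\<close>, a cell lies in one \<open>I a\<close> and is
  moved by one translation.\<close>

lemma cell_translation:
  assumes P: "finite P" "l \<in> P" "r \<in> P" "\<gamma> ` A \<subseteq> P"
    and y: "y \<in> X" and x: "Max {e \<in> P. e \<le> y} \<le> x" "x < Min {e \<in> P. y < e}"
  shows "x \<in> X" "\<And>e. e \<in> P \<Longrightarrow> e \<le> x \<longleftrightarrow> e \<le> y" "T x = T y + (x - y)"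
proof -
  show cell: "e \<le> x \<longleftrightarrow> e \<le> y" if "e \<in> P" for e
  proof
    assume "e \<le> y"
    then have "e \<le> Max {e \<in> P. e \<le> y}" using that P(1) by simp
    then show "e \<le> x" using x by simp
  next
    assume "e \<le> x"
    show "e \<le> y"
    proof (rule ccontr)
      assume "\<not> e \<le> y"
      then have "Min {e \<in> P. y < e} \<le> e" using that P(1) by simp
      then show False using x \<open>e \<le> x\<close> by simp
    qed
  qed
  show "x \<in> X" using cell[of l] cell[of r] P y by auto
  obtain a where a: "a \<in> A" "y \<in> I a" using y by (rule I_cover)
  have "\<gamma> a + lam a \<in> P"
    using gamma_succ[OF a(1)] gamma_Max P by (metis image_subset_iff)
  then have "x \<in> I a" using cell[of "\<gamma> a"] cell[of "\<gamma> a + lam a"] a P(4)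
    by (auto simp: iet_interval_def)
  then show "T x = T y + (x - y)" using T_eq a by simp
qed

text \<open>The component around \<open>z\<close> of the points whose first \<open>N\<close> iterates follow those of \<open>z\<close>.\<close>

lemma translation_interval:
  assumes P: "finite P" "l \<in> P" "r \<in> P" "\<gamma> ` A \<subseteq> P" and z: "z \<in> X"
  obtains p q where "p \<le> z" "z < q" "{p..<q} \<subseteq> X"
    "\<And>x k. x \<in> {p..<q} \<Longrightarrow> k \<le> N \<Longrightarrow> (T ^^ k) x = (T ^^ k) z + (x - z)"
    "\<And>x k e. x \<in> {p..<q} \<Longrightarrow> k \<le> N \<Longrightarrow> e \<in> P \<Longrightarrow> e \<le> (T ^^ k) x \<longleftrightarrow> e \<le> (T ^^ k) z"
    "\<exists>i\<le>N. (T ^^ i) p \<in> P"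
    "\<exists>i\<le>N. \<exists>j\<le>N. \<exists>e\<in>P. \<exists>e'\<in>P. q - p = (e' - e) + ((T ^^ i) z - (T ^^ j) z)"
proof -
  define lo where "lo y = Max {e \<in> P. e \<le> y}" for y
  define hi where "hi y = Min {e \<in> P. y < e}" for y
  have lo: "lo y \<in> P \<and> lo y \<le> y" if "y \<in> X" for y
  proof -
    have "{e \<in> P. e \<le> y} \<noteq> {}" using P(2) that by auto
    from Max_in[OF _ this] show ?thesis using P(1) unfolding lo_def by simp
  qed
  have hi: "hi y \<in> P \<and> y < hi y" if "y \<in> X" for y
  proof -
    have "{e \<in> P. y < e} \<noteq> {}" using P(3) that by auto
    from Min_in[OF _ this] show ?thesis using P(1) unfolding hi_def by simp
  qed
  \<comment> \<open>\<open>f k\<close> and \<open>g k\<close> are the room to the left and right of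
    the \<open>k\<close>-th iterate within its cell \<open>[lo, hi[\<close>; their minima over
    \<open>k \<le> N\<close> determine \<open>p\<close> and \<open>q\<close>.\<close>
  define f where "f k = (T ^^ k) z - lo ((T ^^ k) z)" for k
  define g where "g k = hi ((T ^^ k) z) - (T ^^ k) z" for k
  have "Min (f ` {..N}) \<in> f ` {..N}" "Min (g ` {..N}) \<in> g ` {..N}"
    by (intro Min_in; auto)+
  then obtain i j where i: "i \<le> N" "f i = Min (f ` {..N})" and j: "j \<le> N" "g j = Min (g ` {..N})"
    by (metis atMost_iff imageE)
  have fi: "f i \<le> f k" if "k \<le> N" for k using that i by simp
  have gj: "g j \<le> g k" if "k \<le> N" for k using that j by simp
  define p where "p = z - f i"
  define q where "q = z + g j"
  have zk: "(T ^^ k) z \<in> X" for k using T_pow_in_X z by blast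
  have pz: "p \<le> z" using lo[OF zk] by (simp add: p_def f_def)
  have zq: "z < q" using hi[OF zk] by (simp add: q_def g_def)
  have bounds: "lo ((T ^^ k) z) \<le> (T ^^ k) z + (x - z)" "(T ^^ k) z + (x - z) < hi ((T ^^ k) z)"
    if "x \<in> {p..<q}" "k \<le> N" for x k
    using that fi[of k] gj[of k] by (auto simp: p_def q_def f_def g_def)
  have tr: "(T ^^ k) x = (T ^^ k) z + (x - z)" if "x \<in> {p..<q}" "k \<le> N" for x k
    using that(2)
  proof (induction k)
    case (Suc k)
    then have IH: "(T ^^ k) x = (T ^^ k) z + (x - z)" by simp
    have "T ((T ^^ k) x) = T ((T ^^ k) z) + ((T ^^ k) x - (T ^^ k) z)"
      using bounds[OF that(1), of k] Suc.prems unfolding lo_def hi_def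
      by (intro cell_translation(3)[OF P zk]) (auto simp: IH)
    then show ?case by (simp add: IH)
  qed simp
  show ?thesis
  proof (rule that[OF pz zq _ tr])
    show "{p..<q} \<subseteq> X"
    proof
      fix x assume x: "x \<in> {p..<q}"
      show "x \<in> X"
        using cell_translation(1)[OF P z, of x] bounds[OF x, of 0] by (simp add: lo_def hi_def)
    qed
    show "e \<le> (T ^^ k) x \<longleftrightarrow> e \<le> (T ^^ k) z" if "x \<in> {p..<q}" "k \<le> N" "e \<in> P" for x k e
      using bounds[OF that(1,2)] that(3) unfolding lo_def hi_def
      by (intro cell_translation(2)[OF P zk]) (auto simp: tr[OF that(1,2)])
    \<comment> \<open>At the time \<open>i\<close> limiting the left side, \<open>p\<close> is
      carried exactly to the left end of a cell.\<close>
    have "(T ^^ i) p = lo ((T ^^ i) z)"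
      using tr[of p i] i(1) pz zq by (simp add: p_def f_def)
    then show "\<exists>i\<le>N. (T ^^ i) p \<in> P" using lo[OF zk] i(1) by auto
    have "q - p = (hi ((T ^^ j) z) - lo ((T ^^ i) z)) + ((T ^^ i) z - (T ^^ j) z)"
      by (simp add: p_def q_def f_def g_def)
    then show "\<exists>i\<le>N. \<exists>j\<le>N. \<exists>e\<in>P. \<exists>e'\<in>P. q - p = (e' - e) + ((T ^^ i) z - (T ^^ j) z)"
      using i(1) j(1) lo[OF zk] hi[OF zk] by blast
  qed auto
qed

end

section \<open>Absence of connections\<close>

text \<open>With one letter the map is the identity and every point is periodic, so that case is
  treated separately.\<close>

locale regular_iet = iet +
  assumes regular: "iet_regular l A lam \<pi>" and card_A: "1 < card A"
begin

lemma pow_in_orbit: "(T ^^ m) x \<in> orbit_of T x"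
  unfolding orbit_of_def zpow_def by (auto intro: exI[of _ "int m"])

lemma periodic_finite_orbit:
  assumes "(T ^^ m) x = x" "0 < m"
  shows "finite (orbit_of T x)"
proof -
  have mod: "(T ^^ k) x = (T ^^ (k mod m)) x" for k
    using funpow_mod_eq[OF assms(1)] by simp
  have "orbit_of T x \<subseteq> (\<lambda>i. (T ^^ i) x) ` {..<m}"
  proof
    fix y assume "y \<in> orbit_of T x"
    then obtain k where y: "y = zpow T k x" by (auto simp: orbit_of_def)
    have "\<exists>n. y = (T ^^ n) x"
    proof (cases "0 \<le> k")
      case False
      define n where "n = nat (- k)"
      have "y = (inv T ^^ n) x" using y False by (simp add: zpow_def n_def)
      then have "(T ^^ n) y = x" using T_inv_pow by simp
      \<comment> \<open>Adding \<open>n\<close> periods turns the backward iterate \<open>-n\<close>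
        into the forward iterate \<open>n * m - n\<close>.\<close>
      moreover have "(T ^^ n) ((T ^^ (n * m - n)) x) = (T ^^ (n * m)) x"
        using assms(2) by (simp flip: comp_apply[of "T ^^ n"] funpow_add)
      moreover have "(T ^^ (n * m)) x = x" using mod[of "n * m"] by simp
      ultimately show ?thesis using T_pow_inj by metis
    qed (auto simp: y zpow_def)
    then show "y \<in> (\<lambda>i. (T ^^ i) x) ` {..<m}" using mod assms(2)
      by (metis image_eqI lessThan_iff mod_less_divisor)
  qed
  then show ?thesis by (rule finite_subset) simp
qed

text \<open>A connection between distinct separation points makes their orbits meet; one from a
  point to itself makes its orbit finite.\<close>

lemma no_connection_aux:
  assumes "a \<in> A - {Min A}" "b \<in> A - {Min A}" "0 < m"
  shows "(T ^^ m) (\<gamma> b) \<noteq> \<gamma> a"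
proof
  assume eq: "(T ^^ m) (\<gamma> b) = \<gamma> a"
  show False
  proof (cases "a = b")
    case True
    then show ?thesis using periodic_finite_orbit eq regular assms unfolding iet_regular_def by blast
  next
    case False
    have "\<gamma> a \<in> orbit_of T (\<gamma> a) \<inter> orbit_of T (\<gamma> b)"
      using pow_in_orbit[of 0 "\<gamma> a"] pow_in_orbit[of m "\<gamma> b"] eq by simp
    then show ?thesis using regular assms False unfolding iet_regular_def by blast
  qed
qed

lemma Min_ne_Max: "Min A \<noteq> Max A"
proof
  assume eq: "Min A = Max A"
  have "A \<subseteq> {Min A}"
  proof
    fix a assume "a \<in> A"
    then have "Min A \<le> a" "a \<le> Max A" using finA by simp_all
    then show "a \<in> {Min A}" using eq by simp
  qed
  then have "card A \<le> 1" using card_mono[of "{Min A}" A] by simp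
  then show False using card_A by simp
qed

lemma Min_in_A: "Min A \<in> A" and Max_in_A: "Max A \<in> A"
  using finA A_ne by simp_all

sublocale relabelled: iet l r A "lam \<circ> inv \<pi>" "inv \<pi>"
  using iet_relabel[OF data] by unfold_locales

lemma delta_relabelled: "b \<in> A \<Longrightarrow> \<delta> (inv \<pi> b) = relabelled.\<gamma> b"
  using iet_delta_eq_gamma[OF perm, of "inv \<pi> b" l lam] permutes_in_image[OF relabelled.perm]
    permutes_inverses[OF perm] by simp

lemma inv_in_A: "b \<in> A \<Longrightarrow> inv \<pi> b \<in> A"
  using permutes_in_image[OF relabelled.perm] by simp

text \<open>
  If the first interval were fixed, the second separation point would be the image of a separation
  point other than \<open>\<gamma>\<^sub>1\<close>.
\<close>

lemma Min_not_fixed: "inv \<pi> (Min A) \<noteq> Min A"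
proof
  assume fix1: "inv \<pi> (Min A) = Min A"
  obtain c where c: "c \<in> A" "Min A < c" "\<gamma> c = \<gamma> (Min A) + lam (Min A)"
    "{e \<in> A. e < c} = {e \<in> A. e \<le> Min A}"
    using gamma_succ[OF Min_in_A Min_ne_Max] by blast
  have single: "{e \<in> A. e < c} = {Min A}" unfolding c(4) using finA Min_in_A
    by (auto intro: antisym)
  have "\<delta> (inv \<pi> c) = l + lam (Min A)"
    unfolding delta_relabelled[OF c(1)] iet_gamma_def single using fix1 by simp
  then have "(T ^^ 1) (\<gamma> (inv \<pi> c)) = \<gamma> c"
    using T_gamma[OF inv_in_A[OF c(1)]] c(3) gamma_Min by simp
  moreover have "inv \<pi> c \<noteq> Min A"
    using fix1 c(2) permutes_inj[OF relabelled.perm] by (metis injD less_irrefl)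
  ultimately show False using no_connection_aux[of c "inv \<pi> c" 1] c(1,2) inv_in_A by auto
qed

lemma T_hits_l: "T (\<gamma> (inv \<pi> (Min A))) = l"
  using T_gamma[OF inv_in_A[OF Min_in_A]] delta_relabelled[OF Min_in_A] relabelled.gamma_Min by simp

text \<open>The point \<open>l\<close> is the image of a separation point other than itself, so a
  connection starting at \<open>l\<close> extends one step backwards to an excluded one.\<close>

lemma no_connection:
  assumes "a \<in> A - {Min A}" "b \<in> A" "0 < m"
  shows "(T ^^ m) (\<gamma> b) \<noteq> \<gamma> a"
proof (cases "b = Min A")
  case True
  have "(T ^^ m) (\<gamma> b) = (T ^^ Suc m) (\<gamma> (inv \<pi> (Min A)))"
    using T_hits_l gamma_Min True by (simp add: funpow_swap1)
  then show ?thesis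
    using no_connection_aux[OF assms(1), of "inv \<pi> (Min A)" "Suc m"] Min_not_fixed inv_in_A[OF Min_in_A]
    by auto
qed (use no_connection_aux assms in auto)

text \<open>Sliding a periodic point to the left end of its component yields a periodic separation point.\<close>

lemma no_periodic:
  assumes "z \<in> X" "0 < m"
  shows "(T ^^ m) z \<noteq> z"
proof
  assume per: "(T ^^ m) z = z"
  let ?P = "insert l (insert r (\<gamma> ` A))"
  have P: "finite ?P" "l \<in> ?P" "r \<in> ?P" "\<gamma> ` A \<subseteq> ?P" using finA by auto
  obtain p q where pq: "p \<le> z" "z < q" "{p..<q} \<subseteq> X"
    "\<And>x k. x \<in> {p..<q} \<Longrightarrow> k \<le> m \<Longrightarrow> (T ^^ k) x = (T ^^ k) z + (x - z)"
    "\<exists>i\<le>m. (T ^^ i) p \<in> ?P"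
    by (rule translation_interval[OF P assms(1), of m]) (rule that)
  have pX: "p \<in> X" using subsetD[OF pq(3), of p] pq(1,2) by simp
  have pp: "(T ^^ m) p = p" using pq(4)[of p m] pq(1,2) per by simp
  obtain i where i: "(T ^^ i) p \<in> ?P" using pq(5) by blast
  have "(T ^^ i) p \<in> X" using pX T_pow_in_X by blast
  moreover have "l \<in> \<gamma> ` A" using gamma_Min Min_in_A by (metis image_eqI)
  ultimately have "(T ^^ i) p \<in> \<gamma> ` A" using i by auto
  then obtain a where a: "a \<in> A" "(T ^^ i) p = \<gamma> a" by auto
  have per': "(T ^^ m) (\<gamma> a) = \<gamma> a"
  proof -
    have "(T ^^ m) ((T ^^ i) p) = (T ^^ i) ((T ^^ m) p)"
      by (metis add.commute comp_apply funpow_add)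
    then show ?thesis using a pp by simp
  qed
  show False
  proof (cases "a = Min A")
    case True
    \<comment> \<open>If the periodic point is \<open>l\<close>, its preimage is a periodic
      separation point other than \<open>l\<close>.\<close>
    let ?b = "\<gamma> (inv \<pi> (Min A))"
    have "T ((T ^^ m) ?b) = T ?b"
      using per' True gamma_Min T_hits_l by (simp add: funpow_swap1)
    then have "(T ^^ m) ?b = ?b" using T_inj by simp
    then show ?thesis using no_connection[of "inv \<pi> (Min A)" "inv \<pi> (Min A)" m]
        Min_not_fixed inv_in_A[OF Min_in_A] assms(2) by blast
  qed (use no_connection[of a a m] per' a assms(2) in auto)
qed

text \<open>\<open>r\<close> closes the image of some \<open>I a\<close> with \<open>a\<close> not
  the last letter, so the right end of \<open>I a\<close> is a separation point. This puts
  \<open>r\<close> into the quadratic ring.\<close>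

lemma r_eq:
  obtains a b where "a \<in> A" "b \<in> A" "r = \<alpha> a + \<gamma> b"
proof -
  define a where "a = inv \<pi> (Max A)"
  have a: "a \<in> A" using inv_in_A Max_in_A by (simp add: a_def)
  have r: "r = \<delta> a + lam a"
    using relabelled.gamma_Max delta_relabelled[OF Max_in_A] by (simp add: a_def)
  \<comment> \<open>Otherwise \<open>\<gamma> a\<close> would be a fixed point, hence a connection
    to itself.\<close>
  have "a \<noteq> Max A"
  proof
    assume eq: "a = Max A"
    then have "\<delta> a = \<gamma> a" using r gamma_Max by simp
    then show False using no_connection[of a a 1] T_gamma[OF a] a Min_ne_Max eq by simp
  qed
  then obtain b where "b \<in> A" "\<gamma> b = \<gamma> a + lam a" using gamma_succ a by blast
  then show ?thesis using r a by (intro that[of a b]) (auto simp: iet_alpha_def)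
qed

end

section \<open>Linear recurrence\<close>

lemma harmonic_dyadic:
  assumes "0 < n"
  shows "real m / 2 \<le> (\<Sum>k\<in>{n..<2 ^ m * n}. 1 / real k)"
proof (induction m)
  case (Suc m)
  let ?M = "2 ^ m * n"
  have M: "0 < ?M" using assms by simp
  \<comment> \<open>The next dyadic block has \<open>?M\<close> terms, each at least
    \<open>1 / (2 * ?M)\<close>.\<close>
  have "1 / 2 = (\<Sum>k\<in>{?M..<2 * ?M}. 1 / (2 * real ?M))"
    using assms by simp
  also have "\<dots> \<le> (\<Sum>k\<in>{?M..<2 * ?M}. 1 / real k)"
  proof (rule sum_mono)
    fix k assume "k \<in> {?M..<2 * ?M}"
    then have "0 < k" "k \<le> 2 * ?M" using M by auto
    then have "0 < real k" "real k \<le> real (2 * ?M)" by (simp_all only: of_nat_0_less_iff of_nat_le_iff)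
    then show "1 / (2 * real ?M) \<le> 1 / real k" by (intro divide_left_mono) auto
  qed
  finally have half: "1 / 2 \<le> (\<Sum>k\<in>{?M..<2 * ?M}. 1 / real k)" .
  have "{n..<2 ^ Suc m * n} = {n..<?M} \<union> {?M..<2 * ?M}"
    using ivl_disj_un_two(3)[of n ?M "2 * ?M"] by (simp add: mult.assoc)
  then have "(\<Sum>k\<in>{n..<2 ^ Suc m * n}. 1 / real k)
      = (\<Sum>k\<in>{n..<?M}. 1 / real k) + (\<Sum>k\<in>{?M..<2 * ?M}. 1 / real k)"
    by (simp add: sum.union_disjoint)
  then show ?case using Suc half by simp
qed simp

text \<open>If \<open>N\<close> reached \<open>2 ^ m * n\<close>, the measures \<open>c / k\<close>
  would add up to at least \<open>c * m / 2\<close>, more than \<open>r - l\<close>.\<close>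

lemma disjoint_intervals_harmonic:
  fixes l r c :: real
  assumes "0 < c" "0 < n" and lr: "l \<le> r"
    and int: "\<And>k. k \<in> {n..<N} \<Longrightarrow> \<exists>a. {a..<a + c / real k} \<subseteq> E k"
    and sub: "\<And>k. k \<in> {n..<N} \<Longrightarrow> E k \<subseteq> {l..<r}"
    and disj: "disjoint_family_on E {n..<N}"
    and m: "2 * (r - l) / c < real m"
  shows "N < 2 ^ m * n"
proof (rule ccontr)
  assume "\<not> N < 2 ^ m * n"
  then have sub': "{n..<2 ^ m * n} \<subseteq> {n..<N}" by auto
  obtain a where a: "\<And>k. k \<in> {n..<N} \<Longrightarrow> {a k..<a k + c / real k} \<subseteq> E k" using int by metis
  let ?F = "\<lambda>k. {a k..<a k + c / real k}"
  have fin: "emeasure lborel {x..<y} \<noteq> top" for x y :: real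
    using emeasure_bounded_finite[of "{x..<y}"] bounded_subset[OF bounded_closed_interval, of "{x..<y}" x y]
    by (simp add: less_top atLeastLessThan_subseteq_atLeastAtMost_iff)
  have "disjoint_family_on ?F {n..<2 ^ m * n}"
    using disj a sub' unfolding disjoint_family_on_def by blast
  then have "measure lborel (\<Union>k\<in>{n..<2 ^ m * n}. ?F k) = (\<Sum>k\<in>{n..<2 ^ m * n}. measure lborel (?F k))"
    by (intro measure_finite_Union) (auto simp: fin)
  also have "\<dots> = (\<Sum>k\<in>{n..<2 ^ m * n}. c * (1 / real k))"
    using assms(1) by (intro sum.cong) auto
  also have "\<dots> = c * (\<Sum>k\<in>{n..<2 ^ m * n}. 1 / real k)" by (simp only: sum_distrib_left)
  also have "\<dots> \<ge> c * (real m / 2)"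
    using harmonic_dyadic[OF assms(2)] assms(1) by (intro mult_left_mono) auto
  finally have "c * (real m / 2) \<le> measure lborel (\<Union>k\<in>{n..<2 ^ m * n}. ?F k)" .
  also have "\<dots> \<le> measure lborel {l..<r}"
  proof (rule measure_mono_fmeasurable)
    have "?F k \<subseteq> {l..<r}" if "k \<in> {n..<2 ^ m * n}" for k
      using a[of k] sub[of k] sub' that by (meson subset_iff)
    then show "(\<Union>k\<in>{n..<2 ^ m * n}. ?F k) \<subseteq> {l..<r}" by blast
    show "{l..<r} \<in> fmeasurable lborel" using fin[of l r] by (intro fmeasurableI) (auto simp: less_top)
  qed auto
  finally show False using lr m assms(1) by (simp add: field_simps)
qed

section \<open>Coefficients along orbits\<close>

locale quadratic_iet = regular_iet + quadratic +
  assumes gamma_ring: "a \<in> A \<Longrightarrow> \<gamma> a \<in> Zsqrt d" and alpha_ring: "a \<in> A \<Longrightarrow> \<alpha> a \<in> Zsqrt d"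
begin

lemma r_ring: "r \<in> Zsqrt d"
  using r_eq gamma_ring alpha_ring Zsqrt_add by metis

lemma ex_coefficient_bound:
  "\<exists>D\<ge>1. insert r (\<gamma> ` A \<union> \<alpha> ` A) \<subseteq> bounded_ring D"
proof -
  obtain B where B: "0 \<le> B" "insert r (\<gamma> ` A \<union> \<alpha> ` A) \<subseteq> bounded_ring B"
    by (rule Zsqrt_finite_bounded[of "insert r (\<gamma> ` A \<union> \<alpha> ` A)"])
      (use finA r_ring gamma_ring alpha_ring in auto)
  then show ?thesis
    by (intro exI[of _ "max 1 B"]) (meson bounded_ring_mono max.cobounded1 max.cobounded2 subset_iff)
qed

definition D :: real where
  "D = (SOME D. 1 \<le> D \<and> insert r (\<gamma> ` A \<union> \<alpha> ` A) \<subseteq> bounded_ring D)"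

lemma D: "1 \<le> D" "r \<in> bounded_ring D" "a \<in> A \<Longrightarrow> \<gamma> a \<in> bounded_ring D"
  "a \<in> A \<Longrightarrow> \<alpha> a \<in> bounded_ring D"
  using someI_ex[OF ex_coefficient_bound, folded D_def] by auto

lemma l_ring: "l \<in> bounded_ring D"
  using D(3)[OF Min_in_A] gamma_Min by simp

lemma displacement:
  assumes "z \<in> X"
  shows "(T ^^ k) z - z \<in> bounded_ring (real k * D)"
proof (induction k)
  case 0
  then show ?case using bounded_ring_zero by simp
next
  case (Suc k)
  obtain a where a: "a \<in> A" "(T ^^ k) z \<in> I a" using T_pow_in_X[OF assms] by (rule I_cover)
  have "((T ^^ k) z - z) + \<alpha> a \<in> bounded_ring (real k * D + D)"
    using Suc D(4)[OF a(1)] by (rule bounded_ring_add)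
  then show ?case using T_eq[OF a] by (simp add: algebra_simps)
qed

lemma displacement_between:
  assumes "z \<in> X" "i \<le> N" "j \<le> N"
  shows "(T ^^ i) z - (T ^^ j) z \<in> bounded_ring (real N * D)"
proof -
  have *: "(T ^^ j) z - (T ^^ i) z \<in> bounded_ring (real N * D)" if "i \<le> j" "j \<le> N" for i j
  proof -
    have "(T ^^ (j - i)) ((T ^^ i) z) = (T ^^ j) z"
      using that(1) by (simp flip: comp_apply[of "T ^^ (j - i)"] funpow_add)
    then have "(T ^^ j) z - (T ^^ i) z \<in> bounded_ring (real (j - i) * D)"
      using displacement[OF T_pow_in_X[OF assms(1)], of "j - i" i] by simp
    then show ?thesis using that D(1) by (elim bounded_ring_mono) (auto intro!: mult_right_mono)
  qed
  show ?thesis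
  proof (cases "i \<le> j")
    case True
    then show ?thesis using bounded_ring_uminus[OF *[of i j]] assms by simp
  qed (use *[of j i] assms in auto)
qed

text \<open>The factor 3 counts the summands in the length of a translation interval: two points of
  the partition and one displacement, each with coefficients at most \<open>N * D\<close>.\<close>

definition c0 :: real where "c0 = 1 / ((1 + s) * (3 * D))"

text \<open>The exponent exceeds \<open>2 * (r - l) / c0\<close>, as the harmonic estimate
  requires.\<close>

definition K :: nat where "K = 2 ^ (nat \<lceil>2 * (r - l) / c0\<rceil> + 1)"

lemma c0_pos: "0 < c0"
proof -
  have "0 < 1 + s" "0 < 3 * D" using s_gt1 D(1) by linarith+
  then show ?thesis unfolding c0_def by simp
qed

section \<open>Return and hitting times\<close>

lemma disjoint_long_intervals:
  assumes "0 < n"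
    and "\<And>k. k \<in> {n..<N} \<Longrightarrow> \<exists>a. {a..<a + c0 / real k} \<subseteq> E k"
    and "\<And>k. k \<in> {n..<N} \<Longrightarrow> E k \<subseteq> X"
    and "disjoint_family_on E {n..<N}"
  shows "N < K * n"
  unfolding K_def
proof (rule disjoint_intervals_harmonic[OF c0_pos assms(1) _ assms(2-4)])
  show "2 * (r - l) / c0 < real (nat \<lceil>2 * (r - l) / c0\<rceil> + 1)" by linarith
qed (use lr in auto)

text \<open>The length is a positive ring element with coefficients at most
  \<open>3 * N * D\<close>; \<open>n \<le> N\<close> and \<open>1 \<le> D\<close> bring
  \<open>u\<close> and \<open>v\<close> under \<open>N * D\<close>.\<close>

lemma long_translation_interval:
  assumes n: "0 < n" "n \<le> N" and uv: "u \<in> bounded_ring (real n)" "v \<in> bounded_ring (real n)"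
    and z: "z \<in> X"
  obtains p q where "p \<le> z" "z < q" "{p..<q} \<subseteq> X" "p + c0 / real N \<le> q"
    "\<And>x k. x \<in> {p..<q} \<Longrightarrow> k \<le> N \<Longrightarrow> (T ^^ k) x = (T ^^ k) z + (x - z)"
    "\<And>x k. x \<in> {p..<q} \<Longrightarrow> k \<le> N \<Longrightarrow> (T ^^ k) x \<in> {u..<v} \<longleftrightarrow> (T ^^ k) z \<in> {u..<v}"
proof -
  let ?P = "{l, r, u, v} \<union> \<gamma> ` A"
  have P: "finite ?P" "l \<in> ?P" "r \<in> ?P" "\<gamma> ` A \<subseteq> ?P" using finA by auto
  obtain p q where pq: "p \<le> z" "z < q" "{p..<q} \<subseteq> X"
    "\<And>x k. x \<in> {p..<q} \<Longrightarrow> k \<le> N \<Longrightarrow> (T ^^ k) x = (T ^^ k) z + (x - z)"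
    "\<And>x k e. x \<in> {p..<q} \<Longrightarrow> k \<le> N \<Longrightarrow> e \<in> ?P \<Longrightarrow> e \<le> (T ^^ k) x \<longleftrightarrow> e \<le> (T ^^ k) z"
    "\<exists>i\<le>N. \<exists>j\<le>N. \<exists>e\<in>?P. \<exists>e'\<in>?P. q - p = (e' - e) + ((T ^^ i) z - (T ^^ j) z)"
    by (rule translation_interval[OF P z, of N]) (rule that)
  have nD: "real n \<le> real N * D" "D \<le> real N * D"
    using n D(1) mult_mono[of "real n" "real N" 1 D] mult_right_mono[of 1 "real N" D] by auto
  have P_ring: "e \<in> bounded_ring (real N * D)" if "e \<in> ?P" for e
    using that D(2,3) l_ring uv nD bounded_ring_mono by auto
  obtain i j e e' where "i \<le> N" "j \<le> N" "e \<in> ?P" "e' \<in> ?P"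
    and eq: "q - p = (e' - e) + ((T ^^ i) z - (T ^^ j) z)" using pq(6) by blast
  then have "q - p \<in> bounded_ring (real N * D + real N * D + real N * D)"
    unfolding eq by (intro bounded_ring_add[OF bounded_ring_diff] P_ring displacement_between z)
  then have "1 / ((1 + s) * (real N * D + real N * D + real N * D)) \<le> q - p"
    using pq(1,2) by (intro bounded_ring_lower) auto
  moreover have "c0 / real N = 1 / ((1 + s) * (real N * D + real N * D + real N * D))"
    unfolding c0_def by (simp add: algebra_simps)
  ultimately have len: "p + c0 / real N \<le> q" by linarith
  show ?thesis
  proof (rule that[OF pq(1-3) len pq(4)])
    show "(T ^^ k) x \<in> {u..<v} \<longleftrightarrow> (T ^^ k) z \<in> {u..<v}" if "x \<in> {p..<q}" "k \<le> N" for x k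
      using pq(5)[OF that, of u] pq(5)[OF that, of v] by (auto simp: not_le[symmetric])
  qed
qed

text \<open>
  If the return takes more than \<open>N\<close> steps, then for \<open>n \<le> k \<le> N\<close> the sets of points whose last visit
  was exactly \<open>k\<close> steps ago are disjoint, and each contains an interval of length \<open>c0 / k\<close>.
\<close>

lemma return_time:
  assumes n: "0 < n" and uv: "u \<in> bounded_ring (real n)" "v \<in> bounded_ring (real n)"
    and J: "{u..<v} \<subseteq> X" and z: "z \<in> {u..<v}"
    and avoid: "\<And>k. 0 < k \<Longrightarrow> k \<le> N \<Longrightarrow> (T ^^ k) z \<notin> {u..<v}"
  shows "N < K * n"
proof -
  define E where "E k = {(T ^^ k) y | y. y \<in> {u..<v} \<and> (\<forall>i. 0 < i \<longrightarrow> i \<le> k \<longrightarrow> (T ^^ i) y \<notin> {u..<v})}" for k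
  have "\<exists>a. {a..<a + c0 / real k} \<subseteq> E k" if k: "k \<in> {n..<Suc N}" for k
  proof -
    have zX: "z \<in> X" using z J by blast
    have nk: "n \<le> k" using k by simp
    obtain p q where pq: "p \<le> z" "z < q" "p + c0 / real k \<le> q"
      "\<And>x i. x \<in> {p..<q} \<Longrightarrow> i \<le> k \<Longrightarrow> (T ^^ i) x = (T ^^ i) z + (x - z)"
      "\<And>x i. x \<in> {p..<q} \<Longrightarrow> i \<le> k \<Longrightarrow> (T ^^ i) x \<in> {u..<v} \<longleftrightarrow> (T ^^ i) z \<in> {u..<v}"
      by (rule long_translation_interval[OF n nk uv zX]) (rule that)
    let ?a = "(T ^^ k) z + (p - z)"
    have "y \<in> E k" if y: "y \<in> {?a..<?a + c0 / real k}" for y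
    proof -
      define x where "x = y - (T ^^ k) z + z"
      have x: "x \<in> {p..<q}" using y pq(3) by (auto simp: x_def)
      have "y = (T ^^ k) x" using pq(4)[OF x order_refl] by (simp add: x_def)
      moreover have "x \<in> {u..<v}" using pq(5)[OF x, of 0] z by simp
      moreover have "(T ^^ i) x \<notin> {u..<v}" if "0 < i" "i \<le> k" for i
        using pq(5)[OF x that(2)] avoid[OF that(1)] that(2) k by simp
      ultimately show ?thesis unfolding E_def by blast
    qed
    then show ?thesis by blast
  qed
  moreover have "E k \<subseteq> X" for k unfolding E_def using J T_pow_in_X by blast
  \<comment> \<open>For \<open>i < j\<close> a common point would make \<open>y\<close> visit the
    interval at time \<open>j - i\<close>, contrary to the choice of \<open>y\<close>.\<close>
  moreover have disj: "E i \<inter> E j = {}" if "i < j" for i j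
  proof (rule ccontr)
    assume "E i \<inter> E j \<noteq> {}"
    then obtain x y where x: "x \<in> {u..<v}" and y: "\<And>k. 0 < k \<Longrightarrow> k \<le> j \<Longrightarrow> (T ^^ k) y \<notin> {u..<v}"
      and eq: "(T ^^ i) x = (T ^^ j) y" unfolding E_def by blast
    have "(T ^^ i) ((T ^^ (j - i)) y) = (T ^^ j) y"
      using that by (simp flip: comp_apply[of "T ^^ i"] funpow_add)
    then have "x = (T ^^ (j - i)) y" using eq T_pow_inj by metis
    then show False using y[of "j - i"] x that by simp
  qed
  have "disjoint_family_on E {n..<Suc N}"
    unfolding disjoint_family_on_def
  proof (intro ballI impI)
    show "E i \<inter> E j = {}" if "i \<noteq> j" for i j
      using disj[of i j] disj[of j i] that by (cases i j rule: linorder_cases) auto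
  qed
  ultimately have "Suc N < K * n" by (intro disjoint_long_intervals[OF n, of _ E]) auto
  then show ?thesis by simp
qed

text \<open>The sets of points whose first visit is at time \<open>k\<close> are disjoint, and for
  \<open>n \<le> k \<le> N\<close> each contains an interval of length
  \<open>c0 / k\<close>.\<close>

lemma hitting_time:
  assumes n: "0 < n" and uv: "u \<in> bounded_ring (real n)" "v \<in> bounded_ring (real n)"
    and z: "z \<in> X" "(T ^^ N) z \<in> {u..<v}" and avoid: "\<And>k. k < N \<Longrightarrow> (T ^^ k) z \<notin> {u..<v}"
  shows "N < K * n"
proof -
  define E where "E k = {y \<in> X. (T ^^ k) y \<in> {u..<v} \<and> (\<forall>i<k. (T ^^ i) y \<notin> {u..<v})}" for k
  have "\<exists>a. {a..<a + c0 / real k} \<subseteq> E k" if k: "k \<in> {n..<Suc N}" for k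
  proof -
    \<comment> \<open>After \<open>N - k\<close> steps exactly \<open>k\<close> remain until the
      first visit.\<close>
    let ?w = "(T ^^ (N - k)) z"
    have w: "?w \<in> X" using T_pow_in_X z by blast
    have shift: "(T ^^ i) ?w = (T ^^ (i + (N - k))) z" for i by (simp add: funpow_add)
    have hit: "(T ^^ k) ?w \<in> {u..<v}" and miss: "\<And>i. i < k \<Longrightarrow> (T ^^ i) ?w \<notin> {u..<v}"
      unfolding shift using z k avoid by auto
    have nk: "n \<le> k" using k by simp
    obtain p q where pq: "p \<le> ?w" "?w < q" "{p..<q} \<subseteq> X" "p + c0 / real k \<le> q"
      "\<And>x i. x \<in> {p..<q} \<Longrightarrow> i \<le> k \<Longrightarrow> (T ^^ i) x \<in> {u..<v} \<longleftrightarrow> (T ^^ i) ?w \<in> {u..<v}"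
      by (rule long_translation_interval[OF n nk uv w]) (rule that)
    have "{p..<q} \<subseteq> E k"
    proof
      fix x assume x: "x \<in> {p..<q}"
      show "x \<in> E k" unfolding E_def
        using subsetD[OF pq(3) x] hit miss pq(5)[OF x] by (auto simp del: atLeastLessThan_iff)
    qed
    moreover have "{p..<p + c0 / real k} \<subseteq> {p..<q}" using pq(4) by auto
    ultimately show ?thesis by blast
  qed
  moreover have "E i \<inter> E j = {}" if "i \<noteq> j" for i j
    using that unfolding E_def by (cases i j rule: linorder_cases) auto
  then have "disjoint_family_on E {n..<Suc N}" by (simp add: disjoint_family_on_def)
  ultimately have "Suc N < K * n"
    by (intro disjoint_long_intervals[OF n, of _ E]) (auto simp: E_def)
  then show ?thesis by simp
qed

end

section \<open>Minimality\<close>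

text \<open>The jumps of \<open>S\<close> are finite in number and propagate along orbits except at
  separation points. A jump therefore leads forward to a separation point; from there it propagates
  backward without obstruction, giving infinitely many jumps.\<close>

lemma (in regular_iet) invariant_constant:
  assumes inv: "\<And>x. x \<in> X \<Longrightarrow> S (T x) = S x"
    and e: "0 < e"
    and const: "\<And>x. x \<in> X \<Longrightarrow>
      \<exists>p q. p \<le> x \<and> x < q \<and> p + e \<le> q \<and> {p..<q} \<subseteq> X \<and> (\<forall>y\<in>{p..<q}. S y = S x)"
    and x0: "x0 \<in> X" and y0: "y0 \<in> X"
  shows "S x0 = (S y0 :: bool)"
proof -
  \<comment> \<open>Only jumps from the left can occur, since \<open>const\<close> makes
    \<open>S\<close> constant just to the right of every point.\<close>
  define Bd where "Bd = {x \<in> X. \<forall>t>0. \<exists>y\<in>X. x - t < y \<and> y < x \<and> S y \<noteq> S x}"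
  have Bd_X: "x \<in> X" if "x \<in> Bd" for x using that by (simp add: Bd_def)
  have Bd_gap: "x + e \<le> y" if x: "x \<in> Bd" and y: "y \<in> Bd" and xy: "x < y" for x y
  proof (rule ccontr)
    assume far: "\<not> x + e \<le> y"
    obtain p q where pq: "p \<le> x" "x < q" "p + e \<le> q" "\<And>z. z \<in> {p..<q} \<Longrightarrow> S z = S x"
      using const[of x] Bd_X[OF x] by blast
    have "p = x"
    proof (rule ccontr)
      assume "p \<noteq> x"
      then obtain z where "x - (x - p) < z" "z < x" "S z \<noteq> S x"
        using x pq(1) unfolding Bd_def by (smt (verit) mem_Collect_eq)
      then show False using pq(4)[of z] pq(2) by simp
    qed
    obtain z where z: "y - (y - x) < z" "z < y" "S z \<noteq> S y"
      using y xy unfolding Bd_def by (smt (verit) mem_Collect_eq)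
    have "S z = S x" "S y = S x"
      using pq(4)[of z] pq(4)[of y] z pq(3) far \<open>p = x\<close> xy by auto
    then show False using z by simp
  qed
  have finB: "finite Bd"
  proof (rule inj_on_finite)
    show "inj_on (\<lambda>x. \<lfloor>(x - l) / e\<rfloor>) Bd"
    proof (rule linorder_inj_onI')
      fix x y assume "x \<in> Bd" "y \<in> Bd" "x < y"
      then have "x + e \<le> y" by (rule Bd_gap)
      then have "(x + e - l) / e \<le> (y - l) / e" using e by (intro divide_right_mono) auto
      moreover have "(x + e - l) / e = (x - l) / e + 1" using e by (simp add: field_simps)
      ultimately have "(x - l) / e + 1 \<le> (y - l) / e" by simp
      then show "\<lfloor>(x - l) / e\<rfloor> \<noteq> \<lfloor>(y - l) / e\<rfloor>" by linarith
    qed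
    show "(\<lambda>x. \<lfloor>(x - l) / e\<rfloor>) ` Bd \<subseteq> {0..\<lfloor>(r - l) / e\<rfloor>}"
      using e by (auto simp: Bd_def intro!: floor_mono divide_right_mono)
  qed simp
  \<comment> \<open>Away from separation points a left neighbourhood of \<open>w\<close> is
    translated rigidly, so a jump passes in both directions.\<close>
  have step: "w \<in> Bd \<longleftrightarrow> T w \<in> Bd" if w: "w \<in> X" "w \<notin> \<gamma> ` A" for w
  proof -
    obtain a where a: "a \<in> A" "w \<in> I a" using w(1) by (rule I_cover)
    then have gw: "\<gamma> a < w" using w(2) by (force simp: iet_interval_def)
    have near: "y \<in> I a \<and> y \<in> X \<and> T y = y + \<alpha> a" if "\<gamma> a < y" "y < w" for y
    proof -
      have "y \<in> I a" using that a by (auto simp: iet_interval_def)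
      then show ?thesis using I_subset T_eq a by blast
    qed
    have Tw: "T w = w + \<alpha> a" using T_eq a by blast
    show ?thesis
    proof
      assume wB: "w \<in> Bd"
      have "\<exists>y\<in>X. T w - t < y \<and> y < T w \<and> S y \<noteq> S (T w)" if t: "t > 0" for t
      proof -
        have "0 < min t (w - \<gamma> a)" using t gw by simp
        then obtain y where y: "w - min t (w - \<gamma> a) < y" "y < w" "S y \<noteq> S w"
          using wB unfolding Bd_def by blast
        have ya: "y \<in> X" "T y = y + \<alpha> a" using near[of y] y by auto
        have "S (T y) \<noteq> S (T w)" using y(3) inv[OF w(1)] inv[OF ya(1)] by simp
        moreover have "T w - t < T y" "T y < T w" using y(1,2) ya(2) Tw by auto
        ultimately show ?thesis using T_in_X[OF ya(1)] by blast
      qed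
      then show "T w \<in> Bd" using T_in_X[OF w(1)] by (simp add: Bd_def)
    next
      assume wB: "T w \<in> Bd"
      have "\<exists>y\<in>X. w - t < y \<and> y < w \<and> S y \<noteq> S w" if t: "t > 0" for t
      proof -
        have "0 < min t (w - \<gamma> a)" using t gw by simp
        then obtain y where y: "T w - min t (w - \<gamma> a) < y" "y < T w" "S y \<noteq> S (T w)"
          using wB unfolding Bd_def by blast
        have ya: "y - \<alpha> a \<in> X" "T (y - \<alpha> a) = y" using near[of "y - \<alpha> a"] y Tw by auto
        have "S (y - \<alpha> a) \<noteq> S w" using y(3) inv[OF w(1)] inv[OF ya(1)] ya(2) by simp
        moreover have "w - t < y - \<alpha> a" "y - \<alpha> a < w" using y(1,2) Tw by auto
        ultimately show ?thesis using ya(1) by blast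
      qed
      then show "w \<in> Bd" using w(1) by (simp add: Bd_def)
    qed
  qed
  have not_all: "\<not> (\<forall>k. f k \<in> Bd)" if "\<And>i j. i < j \<Longrightarrow> f i \<noteq> f j" for f :: "nat \<Rightarrow> real"
  proof
    assume "\<forall>k. f k \<in> Bd"
    then have "finite (range f)" using finB by (auto intro: finite_subset)
    moreover have "inj f" using that by (intro linorder_injI) auto
    ultimately show False using finite_imageD infinite_UNIV_nat by blast
  qed
  have "Bd = {}"
  proof (rule ccontr)
    assume "Bd \<noteq> {}"
    then obtain x where x: "x \<in> Bd" by blast
    have "\<exists>a\<in>A. \<gamma> a \<in> Bd"
    proof (rule ccontr)
      assume no: "\<not> (\<exists>a\<in>A. \<gamma> a \<in> Bd)"
      have "(T ^^ k) x \<in> Bd" for k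
      proof (induction k)
        case (Suc k)
        then have "(T ^^ k) x \<notin> \<gamma> ` A" using no by auto
        then show ?case using step[OF Bd_X[OF Suc]] Suc by simp
      qed (use x in simp)
      moreover have "(T ^^ i) x \<noteq> (T ^^ j) x" if "i < j" for i j
      proof -
        have "(T ^^ j) x = (T ^^ (j - i)) ((T ^^ i) x)"
          using that by (simp flip: comp_apply[of "T ^^ (j - i)"] funpow_add)
        then show ?thesis
          using no_periodic[OF T_pow_in_X[OF Bd_X[OF x]], of "j - i" i] that by simp
      qed
      ultimately show False using not_all[of "\<lambda>k. (T ^^ k) x"] by blast
    qed
    then obtain a where a: "a \<in> A" "\<gamma> a \<in> Bd" by blast
    \<comment> \<open>No point of \<open>X\<close> lies to the left of \<open>l\<close>, so
      \<open>l\<close> is not a jump and \<open>no_connection\<close> applies to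
      \<open>a\<close>.\<close>
    then have "\<exists>y\<in>X. \<gamma> a - 1 < y \<and> y < \<gamma> a \<and> S y \<noteq> S (\<gamma> a)"
      unfolding Bd_def using zero_less_one by blast
    then have "\<gamma> a \<noteq> l" by auto
    then have aM: "a \<in> A - {Min A}" using a(1) gamma_Min by auto
    have "(inv T ^^ k) (\<gamma> a) \<in> Bd" for k
    proof (induction k)
      case (Suc k)
      define w where "w = (inv T ^^ Suc k) (\<gamma> a)"
      have Tw: "T w = (inv T ^^ k) (\<gamma> a)"
        using bij_T by (simp add: w_def bij_is_surj surj_f_inv_f)
      have "(T ^^ Suc k) w = \<gamma> a" unfolding w_def by (rule T_inv_pow)
      then have "w \<notin> \<gamma> ` A" using no_connection[OF aM, of _ "Suc k"] by auto
      moreover have "w \<in> X" using Tw Bd_X[OF Suc] T_in_X_iff[of w] by simp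
      ultimately have "w \<in> Bd" using step[of w] Tw Suc by simp
      then show ?case by (simp add: w_def)
    qed (use a in simp)
    moreover have "(inv T ^^ i) (\<gamma> a) \<noteq> (inv T ^^ j) (\<gamma> a)" if "i < j" for i j
    proof
      assume eq: "(inv T ^^ i) (\<gamma> a) = (inv T ^^ j) (\<gamma> a)"
      have "(T ^^ j) ((inv T ^^ i) (\<gamma> a)) = (T ^^ (j - i)) ((T ^^ i) ((inv T ^^ i) (\<gamma> a)))"
        using that by (simp flip: comp_apply[of "T ^^ (j - i)"] funpow_add)
      then have "(T ^^ (j - i)) (\<gamma> a) = \<gamma> a"
        using T_inv_pow[of i "\<gamma> a"] T_inv_pow[of j "\<gamma> a"] by (simp only: eq)
      then show False using no_periodic[OF gamma_in_X[OF a(1)], of "j - i"] that by simp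
    qed
    ultimately show False using not_all[of "\<lambda>k. (inv T ^^ k) (\<gamma> a)"] by blast
  qed
  show ?thesis
  proof (rule connected_local_const[of X])
    show "connected X" by simp
    show "\<forall>x\<in>X. \<forall>\<^sub>F y in at x within X. S x = S y"
    proof
      fix x assume x: "x \<in> X"
      then have "x \<notin> Bd" using \<open>Bd = {}\<close> by simp
      then obtain t where t: "t > 0" "\<And>y. y \<in> X \<Longrightarrow> x - t < y \<Longrightarrow> y < x \<Longrightarrow> S y = S x"
        using x unfolding Bd_def by blast
      obtain p q where pq: "p \<le> x" "x < q" "\<And>y. y \<in> {p..<q} \<Longrightarrow> S y = S x" using const[OF x] by blast
      show "\<forall>\<^sub>F y in at x within X. S x = S y"
        unfolding eventually_at
      proof (intro exI[of _ "min t (q - x)"] conjI ballI impI)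
        fix y assume y: "y \<in> X" "y \<noteq> x \<and> dist y x < min t (q - x)"
        then show "S x = S y"
          using t(2)[of y] pq(3)[of y] pq(1) by (cases "y < x") (auto simp: dist_real_def)
      qed (use t(1) pq(2) in simp)
    qed
  qed (use x0 y0 in auto)
qed

context quadratic_iet
begin

text \<open>Visiting at some time is an invariant property by the bound on return times, and locally
  constant at a uniform scale by that on hitting times. It holds at \<open>u\<close>, hence
  everywhere.\<close>

lemma hits:
  assumes n: "0 < n" and uv: "u \<in> bounded_ring (real n)" "v \<in> bounded_ring (real n)"
    and J: "{u..<v} \<subseteq> X" "u < v" and z: "z \<in> X"
  shows "\<exists>k < K * n. (T ^^ k) z \<in> {u..<v}"
proof -
  define S where "S x = (\<exists>k. (T ^^ k) x \<in> {u..<v})" for x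
  have bounded: "S x \<longleftrightarrow> (\<exists>k < K * n. (T ^^ k) x \<in> {u..<v})" if "x \<in> X" for x
  proof
    assume "S x"
    then have "\<exists>k. (T ^^ k) x \<in> {u..<v}" by (simp only: S_def)
    then obtain k where k: "(T ^^ k) x \<in> {u..<v}" "\<And>i. i < k \<Longrightarrow> (T ^^ i) x \<notin> {u..<v}"
      using exists_least_iff[of "\<lambda>k. (T ^^ k) x \<in> {u..<v}"] by blast
    then show "\<exists>k < K * n. (T ^^ k) x \<in> {u..<v}" using hitting_time[OF n uv that k] by blast
  qed (auto simp: S_def)
  have inv: "S (T x) = S x" if "x \<in> X" for x
  proof
    assume "S (T x)"
    then obtain k where "(T ^^ Suc k) x \<in> {u..<v}" by (auto simp: S_def funpow_swap1)
    then show "S x" unfolding S_def by blast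
  next
    assume "S x"
    then obtain k where k: "(T ^^ k) x \<in> {u..<v}" by (auto simp: S_def)
    have "\<exists>k>0. (T ^^ k) x \<in> {u..<v}"
    proof (cases k)
      case 0
      then have x: "x \<in> {u..<v}" using k by simp
      \<comment> \<open>Avoidance up to time \<open>K * n\<close> would give
        \<open>K * n < K * n\<close>.\<close>
      show ?thesis using return_time[OF n uv J(1) x, of "K * n"] by blast
    qed (use k in blast)
    then obtain j where "(T ^^ Suc j) x \<in> {u..<v}" by (metis gr0_implies_Suc)
    then show "S (T x)" unfolding S_def by (metis funpow_Suc_right comp_apply)
  qed
  have nK: "0 < K * n" "n \<le> K * n" using n by (simp_all add: K_def)
  have "S u = S z"
  proof (rule invariant_constant[of S, OF inv])
    show "0 < c0 / real (K * n)" using c0_pos nK by (intro divide_pos_pos) (simp_all del: of_nat_mult)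
    fix x assume x: "x \<in> X"
    obtain p q where pq: "p \<le> x" "x < q" "{p..<q} \<subseteq> X" "p + c0 / real (K * n) \<le> q"
      "\<And>y k. y \<in> {p..<q} \<Longrightarrow> k \<le> K * n \<Longrightarrow> (T ^^ k) y \<in> {u..<v} \<longleftrightarrow> (T ^^ k) x \<in> {u..<v}"
      by (rule long_translation_interval[OF n nK(2) uv x]) (rule that)
    have "S y = S x" if "y \<in> {p..<q}" for y
      using bounded[OF x] bounded[OF subsetD[OF pq(3) that]] pq(5)[OF that] by (meson less_imp_le)
    then show "\<exists>p q. p \<le> x \<and> x < q \<and> p + c0 / real (K * n) \<le> q \<and> {p..<q} \<subseteq> X \<and>
        (\<forall>y\<in>{p..<q}. S y = S x)"
      using pq(1-4) by blast
  qed (use J z in auto)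
  moreover have "S u" unfolding S_def using J(2) by (intro exI[of _ 0]) simp
  ultimately show ?thesis using bounded[OF z] by blast
qed

lemma forward_hit:
  assumes "0 < n" "u \<in> bounded_ring (real n)" "v \<in> bounded_ring (real n)"
    "{u..<v} \<subseteq> X" "u < v" "z \<in> X"
  obtains k where "0 < k" "k \<le> K * n" "(T ^^ k) z \<in> {u..<v}"
proof -
  \<comment> \<open>Starting from \<open>T z\<close> makes the time positive, as
    \<open>rho_plus\<close> requires.\<close>
  obtain k where k: "k < K * n" "(T ^^ k) (T z) \<in> {u..<v}"
    using hits[OF assms(1-5) T_in_X[OF assms(6)]] by blast
  then have "(T ^^ Suc k) z \<in> {u..<v}" unfolding funpow_Suc_right comp_apply by blast
  then show ?thesis using k(1) by (intro that[of "Suc k"]) (auto simp del: funpow.simps)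
qed

lemma backward_hit:
  assumes "0 < n" "u \<in> bounded_ring (real n)" "v \<in> bounded_ring (real n)"
    "{u..<v} \<subseteq> X" "u < v" "z \<in> X"
  obtains k where "k \<le> K * n" "(inv T ^^ k) z \<in> {u..<v}"
proof -
  \<comment> \<open>The orbit of the preimage \<open>K * n\<close> steps back visits the interval
    before it reaches \<open>z\<close>.\<close>
  let ?w = "(inv T ^^ (K * n)) z"
  have "?w \<in> X" using T_pow_in_X_iff[of "K * n" ?w] assms(6) T_inv_pow by simp
  then obtain k where k: "k < K * n" "(T ^^ k) ?w \<in> {u..<v}" using hits[OF assms(1-5)] by blast
  have "(T ^^ (K * n - k)) ((T ^^ k) ?w) = z"
    using k(1) T_inv_pow[of "K * n" z] by (simp flip: comp_apply[of "T ^^ (K * n - k)"] funpow_add)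
  then have "(T ^^ k) ?w = (inv T ^^ (K * n - k)) z"
    using T_inv_pow T_pow_inj by metis
  then show ?thesis using that[of "K * n - k"] k by simp
qed

end

section \<open>Complexity of admissible semi-intervals\<close>

lemma ereal_le_enat_bounds:
  assumes "- ereal_of_enat (m::enat) \<le> ereal (of_int k)" "ereal (of_int k) < ereal_of_enat p"
    and "m \<le> enat M" "p \<le> enat M"
  shows "- int M \<le> k" "k < int M"
proof -
  have mM: "ereal_of_enat m \<le> ereal (real M)" and pM: "ereal_of_enat p \<le> ereal (real M)"
    using assms(3,4) ereal_of_enat_le_iff[of _ "enat M"] by simp_all
  have "ereal (of_int k) < ereal (real M)" using assms(2) pM by (rule less_le_trans)
  then show "k < int M" by simp
  have "- ereal (real M) \<le> - ereal_of_enat m" using mM by (simp only: ereal_minus_le_minus)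
  also have "\<dots> \<le> ereal (of_int k)" by (rule assms(1))
  finally have "- real M \<le> of_int k" by simp
  then show "- int M \<le> k" by linarith
qed

lemma (in quadratic) lower_constant_pos: "0 < 1 / (2 * (1 + s))"
proof -
  have "0 < 1 + s" using s_gt1 by linarith
  then have "0 < 2 * (1 + s)" by (intro mult_pos_pos) auto
  then show ?thesis by (rule zero_less_divide_1_iff[THEN iffD2])
qed

context quadratic_iet
begin

lemma zpow_displacement:
  assumes "z \<in> X" "\<bar>k\<bar> \<le> int M"
  shows "zpow T k z - z \<in> bounded_ring (real M * D)"
proof (cases "0 \<le> k")
  case True
  then show ?thesis using displacement_between[OF assms(1), of "nat k" M 0] assms(2)
    by (simp add: zpow_def)
next
  case False
  let ?w = "(inv T ^^ nat (- k)) z"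
  have z: "(T ^^ nat (- k)) ?w = z" by (rule T_inv_pow)
  then have "?w \<in> X" using T_pow_in_X_iff[of "nat (- k)" ?w] assms(1) by simp
  from displacement_between[OF this, of 0 M "nat (- k)"] show ?thesis
    using False assms(2) z by (simp add: zpow_def)
qed

text \<open>Visits to the inner interval are visits to \<open>]u, v[\<close>, so both times, and
  with them \<open>\<bar>k\<bar>\<close>, are at most \<open>K * n\<close>.\<close>

lemma neighbours_bounded:
  assumes n: "0 < n" and uv: "u' \<in> bounded_ring (real n)" "v' \<in> bounded_ring (real n)"
    and J: "{u'..<v'} \<subseteq> X" "u' < v'" "{u'..<v'} \<subseteq> {u<..<v}"
    and a: "a \<in> A" and x: "x \<in> neighbours T u v (\<gamma> a)"
  shows "x \<in> bounded_ring (D + real (K * n) * D)"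
proof -
  let ?z = "\<gamma> a"
  have z: "?z \<in> X" using gamma_in_X a by blast
  obtain i where i: "0 < i" "i \<le> K * n" "(T ^^ i) ?z \<in> {u'..<v'}"
    by (rule forward_hit[OF n uv J(1,2) z])
  obtain j where j: "j \<le> K * n" "(inv T ^^ j) ?z \<in> {u'..<v'}"
    by (rule backward_hit[OF n uv J(1,2) z])
  have "zpow T (- int j) ?z = (inv T ^^ j) ?z" by (cases "j = 0") (simp_all add: zpow_def)
  then have "rho_minus T u v ?z \<le> enat j" unfolding rho_minus_def
    using j J(3) by (intro Inf_lower imageI CollectI) auto
  then have m: "rho_minus T u v ?z \<le> enat (K * n)" using j(1) by (meson enat_ord_simps(1) order_trans)
  have "rho_plus T u v ?z \<le> enat i" unfolding rho_plus_def
    using i J(3) by (intro Inf_lower imageI CollectI) (auto simp: zpow_def)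
  then have p: "rho_plus T u v ?z \<le> enat (K * n)" using i(2) by (meson enat_ord_simps(1) order_trans)
  obtain k where k: "x = zpow T k ?z" "- ereal_of_enat (rho_minus T u v ?z) \<le> ereal (of_int k)"
    "ereal (of_int k) < ereal_of_enat (rho_plus T u v ?z)"
    using x unfolding neighbours_def by blast
  have "\<bar>k\<bar> \<le> int (K * n)" using ereal_le_enat_bounds[OF k(2,3) m p] by linarith
  from bounded_ring_add[OF D(3)[OF a] zpow_displacement[OF z this]] show ?thesis
    using k(1) by simp
qed

text \<open>Each half of \<open>]u, v[\<close> contains a ring element at scale \<open>N\<close>,
  about \<open>2 / (v - u)\<close>. The last bound expresses
  \<open>n = O(1 / (v - u))\<close>.\<close>

lemma bounded_subinterval:
  assumes "l \<le> u" "u < v" "v \<le> r"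
  obtains n u' v' where "0 < n" "u' \<in> bounded_ring (real n)" "v' \<in> bounded_ring (real n)"
    "u < u'" "u' < v'" "v' < v"
    "(v - u) * real n \<le> (r - l) * (2 * (\<bar>l\<bar> + \<bar>r\<bar>) + (2 * s + 1)\<^sup>2 + 1) + 2 * (2 * s + 1)\<^sup>2"
proof -
  let ?R = "\<bar>l\<bar> + \<bar>r\<bar>" and ?c = "(2 * s + 1)\<^sup>2"
  define m where "m = (u + v) / 2"
  have um: "u < m" "m < v" using assms by (auto simp: m_def)
  define N where "N = nat \<lceil>2 / (v - u)\<rceil>"
  have pos: "0 < 2 / (v - u)" using assms by simp
  have N: "0 < N" "2 / (v - u) \<le> real N" "real N \<le> 2 / (v - u) + 1"
    using pos unfolding N_def by linarith+
  have "2 \<le> real N * (v - u)" using N(2) assms by (simp add: field_simps)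
  then have len: "1 \<le> real N * (m - u)" "1 \<le> real N * (v - m)"
    by (simp_all add: m_def field_simps)
  obtain u' where u': "u < u'" "u' < m" "u' \<in> bounded_ring (\<bar>u\<bar> + \<bar>m\<bar> + ?c * real N)"
    by (rule dense_at_scale[OF N(1) len(1)])
  obtain v' where v': "m < v'" "v' < v" "v' \<in> bounded_ring (\<bar>m\<bar> + \<bar>v\<bar> + ?c * real N)"
    by (rule dense_at_scale[OF N(1) len(2)])
  define n where "n = nat \<lceil>2 * ?R + ?c * real N\<rceil>"
  have "0 < 2 * s + 1" using s_gt1 by linarith
  then have c: "0 < ?c" by (rule zero_less_power)
  then have posn: "0 < 2 * ?R + ?c * real N" using N(1) by (intro add_nonneg_pos) auto
  have n: "0 < n" "2 * ?R + ?c * real N \<le> real n" "real n \<le> 2 * ?R + ?c * real N + 1"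
    using posn unfolding n_def by linarith+
  have abs_le: "\<bar>x\<bar> \<le> ?R" if "l \<le> x" "x \<le> r" for x using that by linarith
  have "\<bar>u\<bar> \<le> ?R" "\<bar>m\<bar> \<le> ?R" "\<bar>v\<bar> \<le> ?R" using assms um by (auto intro!: abs_le)
  then have R: "\<bar>u\<bar> + \<bar>m\<bar> \<le> 2 * ?R" "\<bar>m\<bar> + \<bar>v\<bar> \<le> 2 * ?R"
    unfolding mult_2 by (simp_all only: add_mono)
  have ring: "u' \<in> bounded_ring (real n)" "v' \<in> bounded_ring (real n)"
    using u'(3) v'(3) R n(2) by (auto elim!: bounded_ring_mono)
  have "real n \<le> 2 * ?R + ?c * (2 / (v - u) + 1) + 1"
    using n(3) mult_left_mono[OF N(3), of ?c] c by linarith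
  then have "(v - u) * real n \<le> (v - u) * (2 * ?R + ?c * (2 / (v - u) + 1) + 1)"
    using assms by (intro mult_left_mono) auto
  also have "\<dots> = (v - u) * (2 * ?R + ?c + 1) + 2 * ?c"
  proof -
    have "(v - u) * (2 * ?R + ?c * (2 / (v - u) + 1) + 1)
        = (v - u) * (2 * ?R + ?c + 1) + ?c * ((v - u) * (2 / (v - u)))" by algebra
    moreover have "(v - u) * (2 / (v - u)) = 2"
      unfolding times_divide_eq_right using assms(2) by (intro nonzero_mult_div_cancel_left) simp
    ultimately show ?thesis by (simp only: mult.commute)
  qed
  also have "\<dots> \<le> (r - l) * (2 * ?R + ?c + 1) + 2 * ?c"
    using assms c by (intro add_right_mono mult_right_mono) auto
  finally show ?thesis
    using u'(1,2) v'(1,2) by (intro that[OF n(1) ring]) auto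
qed

lemma admissible_bounded:
  assumes adm: "iet_admissible l r A lam \<pi> u v"
    and n: "0 < n" "u' \<in> bounded_ring (real n)" "v' \<in> bounded_ring (real n)"
    and uv: "u < u'" "u' < v'" "v' < v"
  shows "u \<in> bounded_ring (D + real (K * n) * D)" "v \<in> bounded_ring (D + real (K * n) * D)"
proof -
  have lr': "l \<le> u" "v \<le> r" using adm by (auto simp: iet_admissible_def)
  have J: "{u'..<v'} \<subseteq> X" "{u'..<v'} \<subseteq> {u<..<v}" using lr' uv by auto
  have "0 \<le> real (K * n) * D" using D(1) by (intro mult_nonneg_nonneg) auto
  then have "r \<in> bounded_ring (D + real (K * n) * D)"
    using D(2) by (elim bounded_ring_mono) auto
  moreover have "x \<in> bounded_ring (D + real (K * n) * D)" if "x \<in> iet_Div l A lam \<pi> u v" for x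
    using that neighbours_bounded[OF n J(1) uv(2) J(2)] unfolding iet_Div_def by blast
  ultimately show "u \<in> bounded_ring (D + real (K * n) * D)" "v \<in> bounded_ring (D + real (K * n) * D)"
    using adm unfolding iet_admissible_def by blast+
qed

lemma reduced_complexity_bounds:
  "\<exists>C1 C2. 0 < C1 \<and> C1 \<le> C2 \<and>
    (\<forall>u v. iet_admissible l r A lam \<pi> u v \<longrightarrow>
       C1 \<le> reduced_complexity d u v \<and> reduced_complexity d u v \<le> C2)"
proof -
  define C where "C = (r - l) * (2 * (\<bar>l\<bar> + \<bar>r\<bar>) + (2 * s + 1)\<^sup>2 + 1) + 2 * (2 * s + 1)\<^sup>2"
  define C1 where "C1 = 1 / (2 * (1 + s))"
  \<comment> \<open>Bounds \<open>(v - u) * (D + K * n * D)\<close> by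
    \<open>v - u \<le> r - l\<close> and \<open>(v - u) * n \<le> C\<close>.\<close>
  define C2 where "C2 = (r - l) * D + real K * D * C"
  have "C1 \<le> reduced_complexity d u v \<and> reduced_complexity d u v \<le> C2"
    if adm: "iet_admissible l r A lam \<pi> u v" for u v
  proof -
    have uv: "l \<le> u" "u < v" "v \<le> r" using adm by (auto simp: iet_admissible_def)
    obtain n u' v' where n: "0 < n" "u' \<in> bounded_ring (real n)" "v' \<in> bounded_ring (real n)"
      and uv': "u < u'" "u' < v'" "v' < v" and C: "(v - u) * real n \<le> C"
      unfolding C_def by (rule bounded_subinterval[OF uv])
    let ?B = "D + real (K * n) * D"
    have B: "u \<in> bounded_ring ?B" "v \<in> bounded_ring ?B" by (rule admissible_bounded[OF adm n uv'])+
    have "C1 \<le> reduced_complexity d u v"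
      unfolding C1_def using B uv(2) bounded_ring_Zsqrt by (intro reduced_complexity_lower) auto
    moreover have "reduced_complexity d u v \<le> (v - u) * ?B"
      unfolding reduced_complexity_def Psi_interval_def
      using Psi_le[OF B(1)] Psi_le[OF B(2)] uv(2) by (intro mult_left_mono) auto
    moreover have "(v - u) * ?B \<le> C2"
    proof -
      have "(v - u) * ?B = (v - u) * D + real K * D * ((v - u) * real n)"
        by (simp add: algebra_simps)
      also have "\<dots> \<le> C2" unfolding C2_def
        using uv D(1) C by (intro add_mono mult_right_mono mult_left_mono) auto
      finally show ?thesis .
    qed
    ultimately show ?thesis by linarith
  qed
  moreover have "0 < C1" unfolding C1_def by (rule lower_constant_pos)
  \<comment> \<open>The maximum ensures \<open>C1 \<le> C2\<close> without exhibiting an admissible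
    interval.\<close>
  ultimately show ?thesis by (intro exI[of _ C1] exI[of _ "max C1 C2"]) fastforce
qed

end

section \<open>The case of a single letter\<close>

lemma neighbours_fixed_point:
  assumes "bij T" "T z = z" "x \<in> neighbours T u v z"
  shows "x = z"
proof -
  have "inv T z = z" using assms(1,2) by (metis bij_inv_eq_iff)
  then have "(inv T ^^ k) z = z" "(T ^^ k) z = z" for k
    using assms(2) by (induction k) auto
  then show ?thesis using assms(3) by (auto simp: neighbours_def zpow_def)
qed

text \<open>The only separation point \<open>l\<close> is fixed, so the only possible ends are
  \<open>l\<close> and \<open>r\<close>.\<close>

lemma (in iet) admissible_single_letter:
  assumes "card A = 1" "iet_admissible l r A lam \<pi> u v"
  shows "u = l" "v = r"
proof -
  obtain a where A: "A = {a}" using assms(1) card_1_singletonE by blast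
  have g: "\<gamma> a = l" using gamma_Min A by simp
  have none: "{b \<in> A. \<pi> b < \<pi> a} = {}" using A by auto
  have "\<delta> a = l" unfolding iet_delta_def none by simp
  then have "T l = l" using T_gamma[of a] A g by simp
  then have "x = l" if "x \<in> iet_Div l A lam \<pi> u v" for x
    using that neighbours_fixed_point[OF bij_T] A g by (auto simp: iet_Div_def)
  then show "u = l" "v = r" using assms(2) unfolding iet_admissible_def by fastforce+
qed

text \<open>With several letters \<open>r\<close> is in the ring by \<open>r_eq\<close>. With one
  letter the separation point and the translation value do not determine \<open>r\<close>, yet
  \<open>[l, r[\<close> is admissible; hence the condition on \<open>r\<close>.\<close>

theorem theorem9:
  fixes d :: int and l r :: real
    and A :: "'a::linorder set" and lam :: "'a \<Rightarrow> real" and \<pi> :: "'a \<Rightarrow> 'a"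
  assumes "2 \<le> d" and "squarefree d"
    and "iet_data l r A lam \<pi>"
    and "iet_regular l A lam \<pi>"
    and "l \<in> Zsqrt d"
    and "\<forall>a\<in>A. iet_gamma l A lam a \<in> Zsqrt d"
    and "\<forall>a\<in>A. iet_alpha l A lam \<pi> a \<in> Zsqrt d"
    and "card A = 1 \<longrightarrow> r \<in> Zsqrt d"
  shows "\<exists>C1 C2. 0 < C1 \<and> C1 \<le> C2 \<and>
    (\<forall>u v. iet_admissible l r A lam \<pi> u v \<longrightarrow>
       C1 \<le> reduced_complexity d u v \<and> reduced_complexity d u v \<le> C2)"
proof (cases "1 < card A")
  case True
  interpret quadratic_iet l r A lam \<pi> d
    using assms True by unfold_locales auto
  show ?thesis by (rule reduced_complexity_bounds)
next
  case False
  interpret iet l r A lam \<pi> using assms(3) by unfold_locales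
  interpret quadratic d using assms(1,2) by unfold_locales
  have card: "card A = 1" using False finA A_ne by (metis One_nat_def Suc_lessI card_gt_0_iff)
  \<comment> \<open>One semi-interval remains, so its reduced complexity serves as both
    constants.\<close>
  let ?C = "reduced_complexity d l r"
  have "1 / (2 * (1 + s)) \<le> ?C"
    using assms(5,8) card lr by (intro reduced_complexity_lower) auto
  then have "0 < ?C" using lower_constant_pos by linarith
  then show ?thesis using admissible_single_letter[OF card]
    by (intro exI[of _ ?C]) fastforce
qed

end
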